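(* Let $c>0$ be a constant. Given a complete undirected $n$-node graph with edge weights $w(\cdot,\cdot)$ in $\{1,\ldots,n^{c}\}$, one can construct, in time linear in the output size, an instance of Tree Edit Distance whose trees have size $O(n)$, with alphabet size $|\Sigma|=O(n)$, such that the minimum weight $\min w(i,j)+w(j,k)+w(i,k)$ of a triangle in the graph can be extracted (is determined by and computable) from the edit distance of this instance.
   Context: Tree Edit Distance (TED): the input is two rooted trees $F,G$ with a left-to-right order among siblings, each node labeled from an alphabet $\Sigma$, together with cost functions $c_{\mathrm{del}}(a)$ (cost of deleting or inserting a node labeled $a$) and $c_{\mathrm{match}}(a,b)$ (cost of changing a label from $a$ to $b$), given explicitly as tables (which are part of the instance, hence of the output of the construction). Deleting a node $v$ makes its children children of $v$'s parent, in place of $v$ in the left-to-right order; insertion is the inverse. The edit distance is the minimum total cost of transforming $F$ into $G$ by such operations, at most one per node. Equivalently, one chooses a bijection between a subset of nodes of $F$ and a subset of nodes of $G$ that preserves the ancestor-descendant and the left-to-right relations in both directions, and pays $c_{\mathrm{match}}$ for each matched pair and $c_{\mathrm{del}}$ for each unmatched node of $F$ and $G$. The size of the trees is their number of nodes. *)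

theory Defs
  imports Complex_Main "HOL-Library.Sublist"
begin

section \<open>Tree edit distance\<close>

datatype (labels: 'a) ltree = Node (root_label: 'a) (children: "'a ltree list")

text \<open>A node is identified with the path of child indices leading to it from the root.\<close>

primrec is_node :: "'a ltree \<Rightarrow> nat list \<Rightarrow> bool" where
  "is_node T [] = True"
| "is_node T (i # p) = (i < length (children T) \<and> is_node (children T ! i) p)"

definition nodes :: "'a ltree \<Rightarrow> nat list set" where
  "nodes T = {p. is_node T p}"

primrec label_at :: "'a ltree \<Rightarrow> nat list \<Rightarrow> 'a" where
  "label_at T [] = root_label T"
| "label_at T (i # p) = label_at (children T ! i) p"

definition tree_size :: "'a ltree \<Rightarrow> nat" where
  "tree_size T = card (nodes T)"

definition ancestor :: "nat list \<Rightarrow> nat list \<Rightarrow> bool" where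
  "ancestor u v \<longleftrightarrow> strict_prefix u v"

definition left_of :: "nat list \<Rightarrow> nat list \<Rightarrow> bool" where
  "left_of u v \<longleftrightarrow> (\<exists>p i j u' v'. u = p @ i # u' \<and> v = p @ j # v' \<and> i < j)"

text \<open>A mapping is the graph of a bijection between a set of nodes of \<open>F\<close> and a set of nodes
  of \<open>G\<close>. As no relation is assumed between the costs, the edit distance is the minimum over
  such mappings (each node takes part in at most one operation), not the cost of a cheapest
  unrestricted sequence of operations.\<close>

definition ted_mappings :: "'a ltree \<Rightarrow> 'a ltree \<Rightarrow> (nat list \<times> nat list) set set" where
  "ted_mappings F G = {M. M \<subseteq> nodes F \<times> nodes G \<and>
     (\<forall>(u, v) \<in> M. \<forall>(u', v') \<in> M.
        (u = u' \<longleftrightarrow> v = v') \<and>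
        (ancestor u u' \<longleftrightarrow> ancestor v v') \<and>
        (left_of u u' \<longleftrightarrow> left_of v v'))}"

definition mapping_cost ::
  "('a \<Rightarrow> nat) \<Rightarrow> ('a \<Rightarrow> 'a \<Rightarrow> nat) \<Rightarrow> 'a ltree \<Rightarrow> 'a ltree \<Rightarrow> (nat list \<times> nat list) set \<Rightarrow> nat" where
  "mapping_cost cdel cmatch F G M =
     (\<Sum>(u, v) \<in> M. cmatch (label_at F u) (label_at G v)) +
     (\<Sum>u \<in> nodes F - fst ` M. cdel (label_at F u)) +
     (\<Sum>v \<in> nodes G - snd ` M. cdel (label_at G v))"

definition edit_distance ::
  "('a \<Rightarrow> nat) \<Rightarrow> ('a \<Rightarrow> 'a \<Rightarrow> nat) \<Rightarrow> 'a ltree \<Rightarrow> 'a ltree \<Rightarrow> nat" where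
  "edit_distance cdel cmatch F G = Min (mapping_cost cdel cmatch F G ` ted_mappings F G)"

text \<open>The two lemmas below show that this minimum ranges over a finite nonempty set.\<close>

lemma finite_nodes: "finite (nodes T)"
proof (induction T)
  case (Node a ts)
  have "nodes (Node a ts) \<subseteq> insert [] (\<Union>i \<in> {..<length ts}. (#) i ` nodes (ts ! i))"
  proof
    fix p assume "p \<in> nodes (Node a ts)"
    then show "p \<in> insert [] (\<Union>i \<in> {..<length ts}. (#) i ` nodes (ts ! i))"
      by (cases p) (auto simp: nodes_def)
  qed
  moreover have "finite (insert [] (\<Union>i \<in> {..<length ts}. (#) i ` nodes (ts ! i)))"
    using Node by auto
  ultimately show ?case
    by (rule finite_subset)
qed

lemma ted_mappings_finite_nonempty: "finite (ted_mappings F G)" "ted_mappings F G \<noteq> {}"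
proof -
  have "ted_mappings F G \<subseteq> Pow (nodes F \<times> nodes G)"
    by (auto simp: ted_mappings_def)
  then show "finite (ted_mappings F G)"
    by (rule finite_subset) (simp add: finite_nodes)
  have "{} \<in> ted_mappings F G"
    by (simp add: ted_mappings_def)
  then show "ted_mappings F G \<noteq> {}"
    by blast
qed

text \<open>The alphabet of an instance is \<open>{..<alphabet_size}\<close>.\<close>

record ted_instance =
  alphabet_size :: nat
  tree1 :: "nat ltree"
  tree2 :: "nat ltree"
  del_cost :: "nat \<Rightarrow> nat"
  match_cost :: "nat \<Rightarrow> nat \<Rightarrow> nat"

definition wf_instance :: "ted_instance \<Rightarrow> bool" where
  "wf_instance I \<longleftrightarrow>
     labels (tree1 I) \<subseteq> {..<alphabet_size I} \<and> labels (tree2 I) \<subseteq> {..<alphabet_size I}"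

definition ted :: "ted_instance \<Rightarrow> nat" where
  "ted I = edit_distance (del_cost I) (match_cost I) (tree1 I) (tree2 I)"

text \<open>A tree is written in preorder, each node as its label followed by its number of children;
  this code is prefix-free, so the word list of an instance determines the alphabet, both trees
  and both cost tables.\<close>

primrec encode_tree :: "nat ltree \<Rightarrow> nat list" where
  "encode_tree (Node a ts) = a # length ts # concat (map encode_tree ts)"

definition encode_instance :: "ted_instance \<Rightarrow> nat list" where
  "encode_instance I =
     alphabet_size I # encode_tree (tree1 I) @ encode_tree (tree2 I) @
     map (del_cost I) [0..<alphabet_size I] @
     concat (map (\<lambda>a. map (match_cost I a) [0..<alphabet_size I]) [0..<alphabet_size I])"

section \<open>Weighted complete graphs\<close>

text \<open>The vertices are \<open>{..<n}\<close>; values of \<open>w\<close> on the diagonal are irrelevant.\<close>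

definition weighted_complete_graph :: "real \<Rightarrow> nat \<Rightarrow> (nat \<Rightarrow> nat \<Rightarrow> nat) \<Rightarrow> bool" where
  "weighted_complete_graph c n w \<longleftrightarrow>
     (\<forall>i<n. \<forall>j<n. i \<noteq> j \<longrightarrow> w i j = w j i \<and> 1 \<le> w i j \<and> real (w i j) \<le> real n powr c)"

definition min_triangle_weight :: "nat \<Rightarrow> (nat \<Rightarrow> nat \<Rightarrow> nat) \<Rightarrow> nat" where
  "min_triangle_weight n w =
     Min {w i j + w j k + w i k | i j k.
            i < n \<and> j < n \<and> k < n \<and> i \<noteq> j \<and> j \<noteq> k \<and> i \<noteq> k}"

definition encode_graph :: "nat \<Rightarrow> (nat \<Rightarrow> nat \<Rightarrow> nat) \<Rightarrow> nat list" where
  "encode_graph n w =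
     n # concat (map (\<lambda>i. map (\<lambda>j. if i = j then 0 else w i j) [0..<n]) [0..<n])"

section \<open>Word RAM\<close>

text \<open>A structured word RAM: registers, a random access memory that initially holds the input,
  and a write-only output tape. Words are the numbers below a bound \<open>B\<close> (word length
  \<open>log B\<close> bits); a command that would create a larger number is stuck, so \<open>exec\<close> only
  relates computations in which all registers and memory cells stay below \<open>B\<close>. Every basic
  command and every test takes one time unit.\<close>

datatype arith_op = Plus | Minus | Times | Divide

fun apply_op :: "arith_op \<Rightarrow> nat \<Rightarrow> nat \<Rightarrow> nat" where
  "apply_op Plus x y = x + y"
| "apply_op Minus x y = x - y"
| "apply_op Times x y = x * y"
| "apply_op Divide x y = x div y"

type_synonym reg = nat

datatype com =
    Skip
  | SetConst reg nat
  | Arith arith_op reg reg reg  \<comment> \<open>target register first\<close>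
  | Load reg reg                \<comment> \<open>target register, register holding the address\<close>
  | Store reg reg               \<comment> \<open>register holding the address, source register\<close>
  | Write reg
  | Seq com com
  | IfLess reg reg com com
  | WhileLess reg reg com

record state =
  regs :: "nat \<Rightarrow> nat"
  mem :: "nat \<Rightarrow> nat"
  out :: "nat list"

inductive exec :: "nat \<Rightarrow> com \<Rightarrow> state \<Rightarrow> nat \<Rightarrow> state \<Rightarrow> bool" for B :: nat where
  Skip: "exec B Skip s 1 s"
| SetConst: "a < B \<Longrightarrow> exec B (SetConst r a) s 1 (s\<lparr>regs := (regs s)(r := a)\<rparr>)"
| Arith: "a = apply_op f (regs s x) (regs s y) \<Longrightarrow> a < B \<Longrightarrow>
    exec B (Arith f r x y) s 1 (s\<lparr>regs := (regs s)(r := a)\<rparr>)"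
| Load: "exec B (Load r x) s 1 (s\<lparr>regs := (regs s)(r := mem s (regs s x))\<rparr>)"
| Store: "exec B (Store x y) s 1 (s\<lparr>mem := (mem s)(regs s x := regs s y)\<rparr>)"
| Write: "exec B (Write x) s 1 (s\<lparr>out := out s @ [regs s x]\<rparr>)"
| Seq: "exec B c1 s t1 s1 \<Longrightarrow> exec B c2 s1 t2 s2 \<Longrightarrow> exec B (Seq c1 c2) s (t1 + t2) s2"
| IfTrue: "regs s x < regs s y \<Longrightarrow> exec B c1 s t s1 \<Longrightarrow>
    exec B (IfLess x y c1 c2) s (Suc t) s1"
| IfFalse: "\<not> regs s x < regs s y \<Longrightarrow> exec B c2 s t s1 \<Longrightarrow>
    exec B (IfLess x y c1 c2) s (Suc t) s1"
| WhileFalse: "\<not> regs s x < regs s y \<Longrightarrow> exec B (WhileLess x y c1) s 1 s"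
| WhileTrue: "regs s x < regs s y \<Longrightarrow> exec B c1 s t1 s1 \<Longrightarrow>
    exec B (WhileLess x y c1) s1 t2 s2 \<Longrightarrow> exec B (WhileLess x y c1) s (Suc (t1 + t2)) s2"

inductive_cases exec_cases:
  "exec B Skip s t s'"
  "exec B (SetConst r a) s t s'"
  "exec B (Arith f r x y) s t s'"
  "exec B (Load r x) s t s'"
  "exec B (Store x y) s t s'"
  "exec B (Write x) s t s'"
  "exec B (Seq c1 c2) s t s'"
  "exec B (IfLess x y c1 c2) s t s'"
  "exec B (WhileLess x y c1) s t s'"

lemma exec_deterministic: "exec B p s t s1 \<Longrightarrow> exec B p s t' s2 \<Longrightarrow> t = t' \<and> s1 = s2"
proof (induction arbitrary: t' s2 rule: exec.induct)
  case (Seq c1 s t1 s1 c2 t2 s3)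
  from Seq.prems show ?case
    by (rule exec_cases(7)) (use Seq.IH in blast)
next
  case (IfTrue s x y c1 t s1 c2)
  from IfTrue.prems show ?case
    by (rule exec_cases(8)) (use IfTrue.hyps IfTrue.IH in blast)+
next
  case (IfFalse s x y c2 t s1 c1)
  from IfFalse.prems show ?case
    by (rule exec_cases(8)) (use IfFalse.hyps IfFalse.IH in blast)+
next
  case (WhileFalse s x y c1)
  from WhileFalse.prems show ?case
    by (rule exec_cases(9)) (use WhileFalse.hyps in simp_all)
next
  case (WhileTrue s x y c1 t1 s1 t2 s3)
  from WhileTrue.prems show ?case
    by (rule exec_cases(9)) (use WhileTrue.hyps WhileTrue.IH in blast)+
qed (erule exec_cases; simp)+

definition initial_state :: "nat list \<Rightarrow> state" where
  "initial_state xs =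
     \<lparr>regs = (\<lambda>_. 0), mem = (\<lambda>i. if i < length xs then xs ! i else 0), out = []\<rparr>"

text \<open>\<open>computes B p xs t ys\<close>: on input \<open>xs\<close>, program \<open>p\<close> halts after exactly \<open>t\<close> steps with
  output \<open>ys\<close>, using words below \<open>B\<close>.\<close>

definition computes :: "nat \<Rightarrow> com \<Rightarrow> nat list \<Rightarrow> nat \<Rightarrow> nat list \<Rightarrow> bool" where
  "computes B p xs t ys \<longleftrightarrow>
     0 < B \<and> set xs \<subseteq> {..<B} \<and> (\<exists>s. exec B p (initial_state xs) t s \<and> out s = ys)"

end

theory Submission
  imports Defs
begin

text \<open>All deletions cost \<open>H\<close>, so a cheapest mapping is one whose pairs have the largest total
  gain, the gain of a pair being \<open>2 * H\<close> minus its matching cost. The first tree is a spine of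
  \<open>2 * n\<close> nodes with a left and a right leaf each; the second has a root with two such spines of
  \<open>n\<close> nodes. Three groups of pairs carry a weight and have gain about \<open>H\<close>:

  \<^item> left leaf \<open>k\<close> of the upper half of the first tree with node \<open>j\<close> of the first spine;
  \<^item> node \<open>i\<close> of the lower half of the first tree with right leaf \<open>j\<close> of the first spine;
  \<^item> right leaf \<open>k\<close> of the upper half of the first tree with node \<open>i\<close> of the second spine.

  In each group a chain faces an antichain, so a mapping contains at most one pair of each group,
  and \<open>H\<close> is so large that an optimal mapping contains all three. It remains to force the two
  occurrences of each index to agree. The ancestor and left-to-right relations give one-sided
  inequalities, against which terms of slope \<open>L\<close> in the gains push; since \<open>L\<close> is not smaller than
  the weight of a lightest triangle, all inequalities are tight in an optimal mapping. For \<open>j\<close>,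
  leaf \<open>j\<close> lies to the right of spine node \<open>j'\<close> only if \<open>j\<close> is attached above \<open>j'\<close>. For \<open>k\<close>, the root of the
  second tree may be matched with a spine node \<open>p\<close> above both leaves \<open>k\<close>, with gain \<open>2 * L * p\<close>.
  For \<open>i\<close>, each pair of a right leaf of the lower half with a left leaf of the second spine has gain
  \<open>2 * L\<close>, and both occurrences of \<open>i\<close> bound the number of such pairs. The degenerate choices, such
  as \<open>i = j\<close>, get weight \<open>U\<close>, which is at least the weight of any triangle.\<close>

section \<open>Nodes of a spine with leaves\<close>

text \<open>A spine continues at child 1, so \<open>down t []\<close> is the path of its node of
  depth \<open>t\<close>, and \<open>down t [0]\<close> and \<open>down t [2]\<close> are the paths
  of the left and right leaf attached there.\<close>

primrec down :: "nat \<Rightarrow> nat list \<Rightarrow> nat list" where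
  "down 0 p = p"
| "down (Suc t) p = 1 # down t p"

section \<open>Ancestor and left-to-right relations between paths\<close>

lemma left_of_Nil [simp]: "\<not> left_of [] v" "\<not> left_of u []"
  by (auto simp: left_of_def)

lemma left_of_Cons [simp]: "left_of (x # u) (y # v) \<longleftrightarrow> x < y \<or> x = y \<and> left_of u v"
proof
  assume "left_of (x # u) (y # v)"
  then obtain p i j u' v' where *: "x # u = p @ i # u'" "y # v = p @ j # v'" "i < j"
    unfolding left_of_def by blast
  show "x < y \<or> x = y \<and> left_of u v"
  proof (cases p)
    case Nil
    then show ?thesis using * by simp
  next
    case (Cons z p')
    then show ?thesis using * unfolding left_of_def by auto
  qed
next
  assume "x < y \<or> x = y \<and> left_of u v"
  then show "left_of (x # u) (y # v)"
  proof
    assume "x < y"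
    then show ?thesis
      unfolding left_of_def by (metis append_Nil)
  next
    assume "x = y \<and> left_of u v"
    then show ?thesis
      unfolding left_of_def by (metis append_Cons)
  qed
qed

lemma ancestor_simps [simp]:
  "ancestor [] v \<longleftrightarrow> v \<noteq> []" "\<not> ancestor u []"
  "ancestor (x # u) (y # v) \<longleftrightarrow> x = y \<and> ancestor u v"
  by (auto simp: ancestor_def strict_prefix_def)

lemma down_eq_iff [simp]:
  "down s [] = down t [] \<longleftrightarrow> s = t"
  "x \<noteq> 1 \<Longrightarrow> down s [x] \<noteq> down t []"
  "x \<noteq> 1 \<Longrightarrow> down t [] \<noteq> down s [x]"
  "x \<noteq> 1 \<Longrightarrow> y \<noteq> 1 \<Longrightarrow> down s [x] = down t [y] \<longleftrightarrow> s = t \<and> x = y"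
proof -
  show "down s [] = down t [] \<longleftrightarrow> s = t"
    by (induction s arbitrary: t; case_tac t) auto
  show *: "x \<noteq> 1 \<Longrightarrow> down s [x] \<noteq> down t []"
    by (induction s arbitrary: t; case_tac t) auto
  then show "x \<noteq> 1 \<Longrightarrow> down t [] \<noteq> down s [x]"
    by metis
  show "x \<noteq> 1 \<Longrightarrow> y \<noteq> 1 \<Longrightarrow> down s [x] = down t [y] \<longleftrightarrow> s = t \<and> x = y"
    by (induction s arbitrary: t; case_tac t) auto
qed

lemma down_eq_Nil [simp]: "down t p = [] \<longleftrightarrow> t = 0 \<and> p = []" "[] = down t p \<longleftrightarrow> t = 0 \<and> p = []"
  by (cases t; auto)+

lemma ancestor_down [simp]:
  "ancestor (down s []) (down t []) \<longleftrightarrow> s < t"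
  "x \<noteq> 1 \<Longrightarrow> ancestor (down s []) (down t [x]) \<longleftrightarrow> s \<le> t"
  "x \<noteq> 1 \<Longrightarrow> \<not> ancestor (down s [x]) (down t [])"
  "x \<noteq> 1 \<Longrightarrow> y \<noteq> 1 \<Longrightarrow> \<not> ancestor (down s [x]) (down t [y])"
  by (induction s arbitrary: t; case_tac t; auto)+

text \<open>Together with \<open>ancestor_down\<close>, this turns every condition on a mapping into
  arithmetic of indices. The values \<open>x < 1\<close> and \<open>1 < x\<close> stand for left and
  right leaves. Among left leaves the higher one comes first, among right leaves the deeper
  one.\<close>

lemma left_of_down [simp]:
  "\<not> left_of (down s []) (down t [])"
  "x \<noteq> 1 \<Longrightarrow> left_of (down s []) (down t [x]) \<longleftrightarrow> t < s \<and> 1 < x"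
  "x \<noteq> 1 \<Longrightarrow> left_of (down s [x]) (down t []) \<longleftrightarrow> s < t \<and> x < 1"
  "x \<noteq> 1 \<Longrightarrow> y \<noteq> 1 \<Longrightarrow> left_of (down s [x]) (down t [y]) \<longleftrightarrow>
    s < t \<and> x < 1 \<or> t < s \<and> 1 < y \<or> s = t \<and> x < y"
  by (induction s arbitrary: t; case_tac t; auto)+

text \<open>A spine grows at the bottom, whereas \<open>down\<close> adds steps at the front of a
  path. Moving a step to the other end reconciles the two recursions.\<close>

lemma down_Suc_shift: "down (Suc t) p = down t (1 # p)"
  by (induction t) auto

text \<open>A label consists of an index \<open>t\<close> and a class \<open>c < 7\<close>. The classes 0, 1 and 2 (in the second
  spine of the second tree 3, 4 and 5) are spine nodes, left leaves and right leaves; 6 is the root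
  of the second tree.\<close>

definition lab :: "nat \<Rightarrow> nat \<Rightarrow> nat" where
  "lab c t = 7 * t + c"

lemma lab_div [simp]: "c < 7 \<Longrightarrow> lab c t div 7 = t"
  and lab_mod [simp]: "c < 7 \<Longrightarrow> lab c t mod 7 = c"
  and lab_dvd [simp]: "c < 7 \<Longrightarrow> 7 dvd lab c t \<longleftrightarrow> c = 0"
  by (simp_all add: lab_def dvd_eq_mod_eq_0)

text \<open>New levels are put directly around \<open>T\<close>, at the bottom, so that the index in
  a label is the depth of the node or, for a leaf, of its parent.\<close>

primrec spine :: "nat \<Rightarrow> nat \<Rightarrow> nat ltree \<Rightarrow> nat ltree" where
  "spine c 0 T = T"
| "spine c (Suc m) T = spine c m
     (Node (lab c m) [Node (lab (c + 1) m) [], T, Node (lab (c + 2) m) []])"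

text \<open>The spine ends in one more node, of index \<open>m\<close> and without leaves. In the
  second tree it represents the last value of \<open>j\<close>, since \<open>j\<close> is
  represented by spine node \<open>Suc j\<close>.\<close>

definition comb :: "nat \<Rightarrow> nat \<Rightarrow> nat ltree" where
  "comb c m = spine c m (Node (lab c m) [])"

section \<open>Nodes, labels and preorder code of a comb\<close>

lemma nodes_leaf [simp]: "nodes (Node a []) = {[]}"
proof -
  have "is_node (Node a []) p \<longleftrightarrow> p = []" for p
    by (cases p) auto
  then show ?thesis by (auto simp: nodes_def)
qed

lemma nodes_Node3: "nodes (Node a [T1, T2, T3]) =
    insert [] ((#) 0 ` nodes T1 \<union> (#) 1 ` nodes T2 \<union> (#) 2 ` nodes T3)"
proof -
  have "is_node (Node a [T1, T2, T3]) p \<longleftrightarrow>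
    p = [] \<or> (\<exists>q. p = 0 # q \<and> is_node T1 q \<or> p = 1 # q \<and> is_node T2 q \<or> p = 2 # q \<and> is_node T3 q)"
    for p
    by (cases p) (auto simp: less_Suc_eq numeral_2_eq_2 numeral_3_eq_3)
  then show ?thesis by (auto simp: nodes_def)
qed

lemma nodes_Node2: "nodes (Node a [T1, T2]) = insert [] ((#) 0 ` nodes T1 \<union> (#) 1 ` nodes T2)"
proof -
  have "is_node (Node a [T1, T2]) p \<longleftrightarrow>
    p = [] \<or> (\<exists>q. p = 0 # q \<and> is_node T1 q \<or> p = 1 # q \<and> is_node T2 q)" for p
    by (cases p) (auto simp: less_Suc_eq)
  then show ?thesis by (auto simp: nodes_def)
qed

lemma nodes_spine: "nodes (spine c m T) =
    (\<lambda>t. down t []) ` {..<m} \<union> (\<lambda>t. down t [0]) ` {..<m} \<union> (\<lambda>t. down t [2]) ` {..<m} \<union>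
    down m ` nodes T"
proof (induction m arbitrary: T)
  case (Suc m)
  show ?case
    by (simp only: spine.simps Suc nodes_Node3 nodes_leaf lessThan_Suc image_insert image_Un
        image_image image_empty down_Suc_shift) blast
qed simp

lemma nodes_comb: "nodes (comb c m) =
    (\<lambda>t. down t []) ` {..m} \<union> (\<lambda>t. down t [0]) ` {..<m} \<union> (\<lambda>t. down t [2]) ` {..<m}"
  by (auto simp: comb_def nodes_spine lessThan_Suc_atMost[symmetric] lessThan_Suc)

lemma card_nodes_comb: "card (nodes (comb c m)) = 3 * m + 1"
proof -
  have i: "inj (\<lambda>t. down t [])" "inj (\<lambda>t. down t [0])" "inj (\<lambda>t. down t [2])"
    by (auto simp: inj_def)
  show ?thesis
    unfolding nodes_comb
    by (subst card_Un_disjoint; (subst card_Un_disjoint)?)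
       (auto simp: card_image inj_on_subset[OF i(1)] inj_on_subset[OF i(2)] inj_on_subset[OF i(3)])
qed

lemma label_at_spine_down: "label_at (spine c m T) (down m p) = label_at T p"
proof (induction m arbitrary: T p)
  case (Suc m)
  show ?case
    by (simp only: spine.simps Suc down_Suc_shift) simp
qed simp

lemma label_at_spine:
  assumes "t < m"
  shows "label_at (spine c m T) (down t []) = lab c t"
    "label_at (spine c m T) (down t [0]) = lab (c + 1) t"
    "label_at (spine c m T) (down t [2]) = lab (c + 2) t"
  using assms
proof (induction m arbitrary: T)
  case (Suc m)
  {
    case 1
    then show ?case using Suc by (cases "t = m") (simp_all add: label_at_spine_down)
  next
    case 2
    then show ?case using Suc by (cases "t = m") (simp_all add: label_at_spine_down)
  next
    case 3
    then show ?case using Suc by (cases "t = m") (simp_all add: label_at_spine_down)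
  }
qed simp_all

lemma label_at_comb [simp]:
  "t \<le> m \<Longrightarrow> label_at (comb c m) (down t []) = lab c t"
  "t < m \<Longrightarrow> label_at (comb c m) (down t [0]) = lab (c + 1) t"
  "t < m \<Longrightarrow> label_at (comb c m) (down t [2]) = lab (c + 2) t"
  by (cases "t = m"; simp add: comb_def label_at_spine label_at_spine_down)
     (simp_all add: comb_def label_at_spine)

lemma labels_spine: "labels (spine c m T) \<subseteq> labels T \<union> {..<7 * m + c + 3}"
proof (induction m arbitrary: T)
  case (Suc m)
  show ?case
    using Suc[of "Node (lab c m) [Node (lab (c + 1) m) [], T, Node (lab (c + 2) m) []]"]
    by (auto simp: lab_def)
qed simp

lemma labels_comb: "labels (comb c m) \<subseteq> {..<7 * m + c + 3}"
  using labels_spine[of c m "Node (lab c m) []"] by (auto simp: comb_def lab_def)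

text \<open>Preorder meets each spine node and its left leaf on the way down, and the right leaves
  on the way back, deepest first. A program can therefore write the code with two loops and without
  a stack.\<close>

lemma encode_spine: "encode_tree (spine c m T) =
    concat (map (\<lambda>t. [lab c t, 3, lab (c + 1) t, 0]) [0..<m]) @ encode_tree T @
    concat (map (\<lambda>t. [lab (c + 2) (m - 1 - t), 0]) [0..<m])"
proof (induction m arbitrary: T)
  case (Suc m)
  have "[0..<Suc m] = 0 # map Suc [0..<m]"
    by (simp add: upt_conv_Cons map_Suc_upt del: upt_Suc)
  then have "concat (map (\<lambda>t. [lab (c + 2) (Suc m - 1 - t), 0]) [0..<Suc m]) =
    [lab (c + 2) m, 0] @ concat (map (\<lambda>t. [lab (c + 2) (m - 1 - t), 0]) [0..<m])"
    by (simp del: upt_Suc add: comp_def)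
  then show ?case
    by (simp only: spine.simps Suc) simp
qed simp

lemma ted_mappingsD:
  assumes "M \<in> ted_mappings F G"
  shows "M \<subseteq> nodes F \<times> nodes G"
    and "(u, v) \<in> M \<Longrightarrow> (u', v') \<in> M \<Longrightarrow> u = u' \<longleftrightarrow> v = v'"
    and "(u, v) \<in> M \<Longrightarrow> (u', v') \<in> M \<Longrightarrow> ancestor u u' \<longleftrightarrow> ancestor v v'"
    and "(u, v) \<in> M \<Longrightarrow> (u', v') \<in> M \<Longrightarrow> left_of u u' \<longleftrightarrow> left_of v v'"
proof -
  have M: "M \<subseteq> nodes F \<times> nodes G \<and> (\<forall>(u, v) \<in> M. \<forall>(u', v') \<in> M.
      (u = u' \<longleftrightarrow> v = v') \<and> (ancestor u u' \<longleftrightarrow> ancestor v v') \<and> (left_of u u' \<longleftrightarrow> left_of v v'))"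
    using assms unfolding ted_mappings_def by (rule CollectD)
  then show "M \<subseteq> nodes F \<times> nodes G"
    by (rule conjunct1)
  have *: "(u = u' \<longleftrightarrow> v = v') \<and> (ancestor u u' \<longleftrightarrow> ancestor v v') \<and> (left_of u u' \<longleftrightarrow> left_of v v')"
    if "(u, v) \<in> M" "(u', v') \<in> M"
    using bspec[OF bspec[OF conjunct2[OF M] that(1), simplified split] that(2)] by simp
  show "(u, v) \<in> M \<Longrightarrow> (u', v') \<in> M \<Longrightarrow> u = u' \<longleftrightarrow> v = v'"
    "(u, v) \<in> M \<Longrightarrow> (u', v') \<in> M \<Longrightarrow> ancestor u u' \<longleftrightarrow> ancestor v v'"
    "(u, v) \<in> M \<Longrightarrow> (u', v') \<in> M \<Longrightarrow> left_of u u' \<longleftrightarrow> left_of v v'"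
    using * by blast+
qed

section \<open>The instance\<close>

text \<open>Deleting all nodes costs \<open>H\<close> times the sum of the sizes. A mapping is
  injective on both sides, so each of its pairs saves two deletions and pays its matching cost
  instead.\<close>

lemma mapping_cost_gain:
  assumes M: "M \<in> ted_mappings F G"
  shows "int (mapping_cost (\<lambda>_. H) cm F G M) = int H * (int (tree_size F) + int (tree_size G)) -
    (\<Sum>(u, v) \<in> M. 2 * int H - int (cm (label_at F u) (label_at G v)))"
proof -
  note sub = ted_mappingsD(1)[OF M]
  have "inj_on fst M" "inj_on snd M"
    using ted_mappingsD(2)[OF M] by (fastforce simp: inj_on_def)+
  then have c: "card (fst ` M) = card M" "card (snd ` M) = card M"
    by (simp_all add: card_image)
  have "fst ` M \<subseteq> nodes F" "snd ` M \<subseteq> nodes G"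
    using sub by auto
  then have "card (nodes F - fst ` M) + card M = tree_size F"
    "card (nodes G - snd ` M) + card M = tree_size G"
    using c card_mono[of "nodes F" "fst ` M"] card_mono[of "nodes G" "snd ` M"]
    by (auto simp: card_Diff_subset finite_subset[OF _ finite_nodes] tree_size_def finite_nodes)
  then have d: "int (card (nodes F - fst ` M)) = int (tree_size F) - int (card M)"
    "int (card (nodes G - snd ` M)) = int (tree_size G) - int (card M)"
    by linarith+
  show ?thesis
    by (simp add: mapping_cost_def d sum_subtractf case_prod_unfold algebra_simps)
qed

definition tree_F :: "nat \<Rightarrow> nat ltree" where
  "tree_F n = comb 0 (2 * n)"

definition tree_G :: "nat \<Rightarrow> nat ltree" where
  "tree_G n = Node 6 [comb 0 n, comb 3 n]"

definition penalized :: "nat \<Rightarrow> (nat \<Rightarrow> nat \<Rightarrow> nat) \<Rightarrow> nat \<Rightarrow> nat \<Rightarrow> nat" where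
  "penalized U w i j = (if i = j then U else w i j)"

text \<open>The factor 2 balances the slopes \<open>- L\<close> of the two occurrences of
  \<open>k\<close>, in \<open>gain_jk\<close> and \<open>gain_ik\<close>. The gain
  \<open>2 * L\<close> in \<open>gain_link\<close> does the same for the two occurrences of
  \<open>i\<close>.\<close>

definition gain_root :: "nat \<Rightarrow> nat \<Rightarrow> nat \<Rightarrow> nat \<Rightarrow> nat" where
  "gain_root n L a b =
     (if a mod 7 = 0 \<and> b mod 7 = 6 \<and> a div 7 < n then 2 * L * (a div 7) else 0)"

text \<open>The index \<open>j\<close> has slope \<open>L\<close> here and \<open>- L\<close> in
  \<open>gain_jk\<close>, so that only the difference of its two occurrences counts.\<close>

definition gain_ij :: "nat \<Rightarrow> nat \<Rightarrow> nat \<Rightarrow> (nat \<Rightarrow> nat \<Rightarrow> nat) \<Rightarrow> nat \<Rightarrow> nat \<Rightarrow> nat" where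
  "gain_ij n L H W a b =
     (if a mod 7 = 0 \<and> b mod 7 = 2 \<and> n \<le> a div 7 \<and> a div 7 < 2 * n \<and> b div 7 < n
      then H + L * (b div 7) - (L * (a div 7 - n) + W (a div 7 - n) (b div 7)) else 0)"

text \<open>The shift by one in the index of the spine node makes \<open>b \<le> j\<close>, rather than \<open>b < j\<close>, the
  condition for right leaf \<open>b\<close> to be right of the node that stands for \<open>j\<close>.\<close>

definition gain_jk :: "nat \<Rightarrow> nat \<Rightarrow> nat \<Rightarrow> (nat \<Rightarrow> nat \<Rightarrow> nat) \<Rightarrow> nat \<Rightarrow> nat \<Rightarrow> nat" where
  "gain_jk n L H W a b =
     (if a mod 7 = 1 \<and> b mod 7 = 0 \<and> a div 7 < n \<and> 0 < b div 7 \<and> b div 7 \<le> n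
      then H - (L * (a div 7) + L * (b div 7 - 1) + W (b div 7 - 1) (a div 7)) else 0)"

definition gain_ik :: "nat \<Rightarrow> nat \<Rightarrow> nat \<Rightarrow> (nat \<Rightarrow> nat \<Rightarrow> nat) \<Rightarrow> nat \<Rightarrow> nat \<Rightarrow> nat" where
  "gain_ik n L H W a b =
     (if a mod 7 = 2 \<and> b mod 7 = 3 \<and> a div 7 < n \<and> b div 7 < n
      then H - (L * (a div 7) + L * (b div 7) + W (b div 7) (a div 7)) else 0)"

definition gain_link :: "nat \<Rightarrow> nat \<Rightarrow> nat \<Rightarrow> nat \<Rightarrow> nat" where
  "gain_link n L a b = (if a mod 7 = 2 \<and> b mod 7 = 4 \<and> n \<le> a div 7 then 2 * L else 0)"

lemmas gain_defs = gain_root_def gain_ij_def gain_jk_def gain_ik_def gain_link_def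

definition gain :: "nat \<Rightarrow> nat \<Rightarrow> nat \<Rightarrow> (nat \<Rightarrow> nat \<Rightarrow> nat) \<Rightarrow> nat \<Rightarrow> nat \<Rightarrow> nat" where
  "gain n L H W a b = gain_root n L a b + gain_ij n L H W a b + gain_jk n L H W a b +
     gain_ik n L H W a b + gain_link n L a b"

text \<open>The slope is \<open>n * U\<close> and the deletion cost is \<open>n ^ 4 * U\<close>.
  Both can be computed from \<open>n\<close> and \<open>U\<close> alone, without looking at the
  weights.\<close>

definition gadget :: "nat \<Rightarrow> nat \<Rightarrow> (nat \<Rightarrow> nat \<Rightarrow> nat) \<Rightarrow> ted_instance" where
  "gadget n U w = \<lparr>alphabet_size = 14 * n + 7, tree1 = tree_F n, tree2 = tree_G n,
     del_cost = (\<lambda>_. n ^ 4 * U),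
     match_cost = (\<lambda>a b. 2 * (n ^ 4 * U) - gain n (n * U) (n ^ 4 * U) (penalized U w) a b)\<rparr>"

lemma wf_gadget: "wf_instance (gadget n U w)"
  using labels_comb[of 0 "2 * n"] labels_comb[of 0 n] labels_comb[of 3 n]
  by (fastforce simp: wf_instance_def gadget_def tree_F_def tree_G_def)

lemma tree_size_F: "tree_size (tree_F n) = 6 * n + 1"
  by (simp add: tree_size_def tree_F_def card_nodes_comb)

lemma tree_size_G: "tree_size (tree_G n) = 6 * n + 3"
proof -
  have "card ((#) 0 ` nodes (comb 0 n) \<union> (#) 1 ` nodes (comb 3 n)) = 6 * n + 2"
    by (subst card_Un_disjoint) (auto simp: finite_nodes card_image card_nodes_comb)
  then show ?thesis
    unfolding tree_size_def tree_G_def nodes_Node2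
    by (subst card_insert_disjoint) (auto simp: finite_nodes)
qed

section \<open>Recovering the positions of a pair from its labels\<close>

lemma node_comb_cases:
  assumes "u \<in> nodes (comb c m)"
  shows "(\<exists>t \<le> m. u = down t [] \<and> label_at (comb c m) u = lab c t) \<or>
    (\<exists>t < m. u = down t [0] \<and> label_at (comb c m) u = lab (c + 1) t) \<or>
    (\<exists>t < m. u = down t [2] \<and> label_at (comb c m) u = lab (c + 2) t)"
  using assms unfolding nodes_comb by (elim UnE imageE) auto

text \<open>No label occurs twice in a tree, so the class and the index of a label determine the
  path. Likewise \<open>node_G\<close> treats those classes of the second tree that take part in a
  gain.\<close>

lemma node_F:
  assumes "u \<in> nodes (tree_F n)" "a = label_at (tree_F n) u"
  shows "a mod 7 = 0 \<Longrightarrow> a div 7 \<le> 2 * n \<and> u = down (a div 7) []"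
    "a mod 7 = 1 \<Longrightarrow> a div 7 < 2 * n \<and> u = down (a div 7) [0]"
    "a mod 7 = 2 \<Longrightarrow> a div 7 < 2 * n \<and> u = down (a div 7) [2]"
  using node_comb_cases[of u 0 "2 * n"] assms unfolding tree_F_def by auto

lemma node_G:
  assumes "v \<in> nodes (tree_G n)" "b = label_at (tree_G n) v"
  shows "b mod 7 = 6 \<Longrightarrow> v = []"
    "b mod 7 = 0 \<Longrightarrow> b div 7 \<le> n \<and> v = 0 # down (b div 7) []"
    "b mod 7 = 2 \<Longrightarrow> b div 7 < n \<and> v = 0 # down (b div 7) [2]"
    "b mod 7 = 3 \<Longrightarrow> b div 7 \<le> n \<and> v = 1 # down (b div 7) []"
    "b mod 7 = 4 \<Longrightarrow> b div 7 < n \<and> v = 1 # down (b div 7) [0]"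
proof -
  consider "v = []" | p where "p \<in> nodes (comb 0 n)" "v = 0 # p"
    | p where "p \<in> nodes (comb 3 n)" "v = 1 # p"
    using assms(1) unfolding tree_G_def nodes_Node2 by blast
  then have "(b mod 7 = 6 \<longrightarrow> v = []) \<and>
    (b mod 7 = 0 \<longrightarrow> b div 7 \<le> n \<and> v = 0 # down (b div 7) []) \<and>
    (b mod 7 = 2 \<longrightarrow> b div 7 < n \<and> v = 0 # down (b div 7) [2]) \<and>
    (b mod 7 = 3 \<longrightarrow> b div 7 \<le> n \<and> v = 1 # down (b div 7) []) \<and>
    (b mod 7 = 4 \<longrightarrow> b div 7 < n \<and> v = 1 # down (b div 7) [0])"
  proof cases
    case 1
    then show ?thesis
      using assms(2) by (simp add: tree_G_def)
  next
    case 2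
    then show ?thesis
      using node_comb_cases[OF 2(1)] assms(2) by (auto simp: tree_G_def)
  next
    case 3
    then show ?thesis
      using node_comb_cases[OF 3(1)] assms(2) by (auto simp: tree_G_def)
  qed
  then show "b mod 7 = 6 \<Longrightarrow> v = []"
    "b mod 7 = 0 \<Longrightarrow> b div 7 \<le> n \<and> v = 0 # down (b div 7) []"
    "b mod 7 = 2 \<Longrightarrow> b div 7 < n \<and> v = 0 # down (b div 7) [2]"
    "b mod 7 = 3 \<Longrightarrow> b div 7 \<le> n \<and> v = 1 # down (b div 7) []"
    "b mod 7 = 4 \<Longrightarrow> b div 7 < n \<and> v = 1 # down (b div 7) [0]"
    by simp_all
qed

text \<open>The gains of the weighted pairs are truncated differences. A nonzero one has not been
  truncated, so the lemmas on nonzero gains pass to integers without any bound on the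
  weights.\<close>

lemma int_nonzero_diff: "z = x - y \<Longrightarrow> z \<noteq> 0 \<Longrightarrow> int z = int x - int y"
  by simp

context
  fixes n u v a b
  assumes u: "u \<in> nodes (tree_F n)" and a: "a = label_at (tree_F n) u"
    and v: "v \<in> nodes (tree_G n)" and b: "b = label_at (tree_G n) v"
begin

lemma gain_root_nonzero:
  assumes "gain_root n L a b \<noteq> 0"
  obtains p where "p < n" "u = down p []" "v = []" "gain_root n L a b = 2 * L * p"
  using assms that[of "a div 7"] node_F[OF u a] node_G[OF v b]
  by (auto simp: gain_root_def split: if_splits)

lemma gain_ij_nonzero:
  assumes "gain_ij n L H W a b \<noteq> 0"
  obtains i j where "i < n" "j < n" "u = down (n + i) []" "v = 0 # down j [2]"
    "int (gain_ij n L H W a b) = int H + int L * int j - int L * int i - int (W i j)"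
proof (rule that[of "a div 7 - n" "b div 7"])
  have c: "a mod 7 = 0" "b mod 7 = 2" "n \<le> a div 7" "a div 7 < 2 * n" "b div 7 < n"
    using assms by (auto simp: gain_ij_def split: if_splits)
  then show "a div 7 - n < n" "b div 7 < n" "u = down (n + (a div 7 - n)) []"
    "v = 0 # down (b div 7) [2]"
    using node_F[OF u a] node_G[OF v b] by auto
  show "int (gain_ij n L H W a b) = int H + int L * int (b div 7) - int L * int (a div 7 - n) -
      int (W (a div 7 - n) (b div 7))"
  proof -
    have "gain_ij n L H W a b = H + L * (b div 7) - (L * (a div 7 - n) + W (a div 7 - n) (b div 7))"
      unfolding gain_ij_def using c by (intro if_P) blast
    from int_nonzero_diff[OF this assms] show ?thesis
      by (simp only: of_nat_add of_nat_mult diff_diff_eq add.assoc)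
  qed
qed

lemma gain_jk_nonzero:
  assumes "gain_jk n L H W a b \<noteq> 0"
  obtains j k where "j < n" "k < n" "u = down k [0]" "v = 0 # down (Suc j) []"
    "int (gain_jk n L H W a b) = int H - int L * int k - int L * int j - int (W j k)"
proof (rule that[of "b div 7 - 1" "a div 7"])
  have c: "a mod 7 = 1" "b mod 7 = 0" "a div 7 < n" "0 < b div 7" "b div 7 \<le> n"
    using assms by (auto simp: gain_jk_def split: if_splits)
  then show "b div 7 - 1 < n" "a div 7 < n" "u = down (a div 7) [0]"
    "v = 0 # down (Suc (b div 7 - 1)) []"
    using node_F[OF u a] node_G[OF v b] by auto
  show "int (gain_jk n L H W a b) = int H - int L * int (a div 7) - int L * int (b div 7 - 1) -
      int (W (b div 7 - 1) (a div 7))"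
  proof -
    have "gain_jk n L H W a b = H - (L * (a div 7) + L * (b div 7 - 1) + W (b div 7 - 1) (a div 7))"
      unfolding gain_jk_def using c by (intro if_P) blast
    from int_nonzero_diff[OF this assms] show ?thesis
      by (simp only: of_nat_add of_nat_mult diff_diff_eq add.assoc)
  qed
qed

lemma gain_ik_nonzero:
  assumes "gain_ik n L H W a b \<noteq> 0"
  obtains i k where "i < n" "k < n" "u = down k [2]" "v = 1 # down i []"
    "int (gain_ik n L H W a b) = int H - int L * int k - int L * int i - int (W i k)"
proof (rule that[of "b div 7" "a div 7"])
  have c: "a mod 7 = 2" "b mod 7 = 3" "a div 7 < n" "b div 7 < n"
    using assms by (auto simp: gain_ik_def split: if_splits)
  then show "b div 7 < n" "a div 7 < n" "u = down (a div 7) [2]" "v = 1 # down (b div 7) []"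
    using node_F[OF u a] node_G[OF v b] by auto
  show "int (gain_ik n L H W a b) = int H - int L * int (a div 7) - int L * int (b div 7) -
      int (W (b div 7) (a div 7))"
  proof -
    have "gain_ik n L H W a b = H - (L * (a div 7) + L * (b div 7) + W (b div 7) (a div 7))"
      unfolding gain_ik_def using c by (intro if_P) blast
    from int_nonzero_diff[OF this assms] show ?thesis
      by (simp only: of_nat_add of_nat_mult diff_diff_eq add.assoc)
  qed
qed

lemma gain_link_nonzero:
  assumes "gain_link n L a b \<noteq> 0"
  obtains p q where "p < n" "q < n" "u = down (n + p) [2]" "v = 1 # down q [0]"
    "gain_link n L a b = 2 * L"
proof (rule that[of "a div 7 - n" "b div 7"])
  have c: "a mod 7 = 2" "b mod 7 = 4" "n \<le> a div 7"
    using assms by (auto simp: gain_link_def split: if_splits)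
  then show "a div 7 - n < n" "b div 7 < n" "u = down (n + (a div 7 - n)) [2]"
    "v = 1 # down (b div 7) [0]" "gain_link n L a b = 2 * L"
    using node_F[OF u a] node_G[OF v b] by (auto simp: gain_link_def)
qed

end

text \<open>Turns the uniqueness of the contributing pair of a group into a value of the whole sum
  over a mapping.\<close>

lemma sum_at_most_one:
  fixes g :: "'a \<Rightarrow> nat"
  assumes "finite M" "\<And>x y. x \<in> M \<Longrightarrow> y \<in> M \<Longrightarrow> g x \<noteq> 0 \<Longrightarrow> g y \<noteq> 0 \<Longrightarrow> x = y"
  shows "sum g M = 0 \<or> (\<exists>x \<in> M. g x \<noteq> 0 \<and> sum g M = g x)"
proof (cases "\<exists>x \<in> M. g x \<noteq> 0")
  case True
  then obtain x where x: "x \<in> M" "g x \<noteq> 0"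
    by blast
  then have "sum g M = sum g {x}"
    using assms by (intro sum.mono_neutral_right) auto
  then show ?thesis
    using x by auto
qed simp

section \<open>The largest gain of a mapping\<close>

text \<open>A triangle has three edges, so the bound on \<open>3 * w i j\<close> makes
  \<open>U\<close> an upper bound on the weight of every triangle. The penalty on the diagonal and
  the slope \<open>L\<close> rely on this.\<close>

locale weights =
  fixes n U :: nat and w :: "nat \<Rightarrow> nat \<Rightarrow> nat"
  assumes three_le_n: "3 \<le> n"
    and triple_le_U: "\<And>i j. i < n \<Longrightarrow> j < n \<Longrightarrow> i \<noteq> j \<Longrightarrow> 3 * w i j \<le> U"
    and U_pos: "0 < U"
begin

abbreviation L where "L \<equiv> n * U"
abbreviation H where "H \<equiv> n ^ 4 * U"
abbreviation W where "W \<equiv> penalized U w"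
abbreviation F where "F \<equiv> tree_F n"
abbreviation G where "G \<equiv> tree_G n"
abbreviation pair_gain :: "(nat \<Rightarrow> nat \<Rightarrow> nat) \<Rightarrow> nat list \<times> nat list \<Rightarrow> nat" where
  "pair_gain g x \<equiv> g (label_at F (fst x)) (label_at G (snd x))"

lemma finite_triangles:
  "finite {w i j + w j k + w i k | i j k. i < n \<and> j < n \<and> k < n \<and> i \<noteq> j \<and> j \<noteq> k \<and> i \<noteq> k}"
proof (rule finite_subset)
  show "{w i j + w j k + w i k | i j k. i < n \<and> j < n \<and> k < n \<and> i \<noteq> j \<and> j \<noteq> k \<and> i \<noteq> k}
    \<subseteq> (\<lambda>(i, j, k). w i j + w j k + w i k) ` ({..<n} \<times> {..<n} \<times> {..<n})"
    by force
qed simp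

lemma min_triangle_attained:
  obtains i j k where "i < n" "j < n" "k < n"
    "min_triangle_weight n w = W i j + W j k + W i k"
proof -
  let ?T = "{w i j + w j k + w i k | i j k. i < n \<and> j < n \<and> k < n \<and> i \<noteq> j \<and> j \<noteq> k \<and> i \<noteq> k}"
  have "w 0 1 + w 1 2 + w 0 2 \<in> ?T"
    using three_le_n by fastforce
  then have "Min ?T \<in> ?T"
    using finite_triangles by (intro Min_in) auto
  then show thesis
    using that unfolding min_triangle_weight_def penalized_def by force
qed

lemma min_triangle_le_U: "min_triangle_weight n w \<le> U"
proof -
  have "w 0 1 + w 1 2 + w 0 2 \<in>
    {w i j + w j k + w i k | i j k. i < n \<and> j < n \<and> k < n \<and> i \<noteq> j \<and> j \<noteq> k \<and> i \<noteq> k}"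
    using three_le_n by fastforce
  then have "min_triangle_weight n w \<le> w 0 1 + w 1 2 + w 0 2"
    unfolding min_triangle_weight_def by (intro Min_le finite_triangles)
  also have "\<dots> \<le> U"
    using triple_le_U[of 0 1] triple_le_U[of 1 2] triple_le_U[of 0 2] three_le_n by simp
  finally show ?thesis .
qed

text \<open>If two of the indices agree, one of the three summands is a diagonal entry of
  \<open>W\<close>, that is \<open>U\<close>, which already dominates the lightest triangle.\<close>

lemma min_triangle_le:
  assumes "i < n" "j < n" "k < n"
  shows "min_triangle_weight n w \<le> W i j + W j k + W i k"
proof (cases "i \<noteq> j \<and> j \<noteq> k \<and> i \<noteq> k")
  case True
  then have "min_triangle_weight n w \<le> w i j + w j k + w i k"
    unfolding min_triangle_weight_def using assms by (intro Min_le finite_triangles) blast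
  then show ?thesis
    using True by (simp add: penalized_def)
next
  case False
  then have "U \<le> W i j + W j k + W i k"
    by (auto simp: penalized_def)
  then show ?thesis
    using min_triangle_le_U by simp
qed

lemma U_le_L: "U \<le> L"
  using three_le_n by simp

text \<open>In a mapping the terms of slope \<open>L\<close> contribute at most
  \<open>5 * (L * n)\<close>. The loss of a single \<open>H\<close> therefore cannot be made up for.
  Since \<open>L * n = n * n * U\<close>, the claim follows from
  \<open>9 * (n * n) \<le> n ^ 4\<close>.\<close>

lemma H_large: "5 * (L * n) + 3 * U \<le> H"
proof -
  have "3 * 3 \<le> n * n"
    using three_le_n by (intro mult_mono) auto
  then have "9 * (n * n) \<le> (n * n) * (n * n)" "9 \<le> n * n"
    by auto
  then have "5 * (n * n) + 3 \<le> (n * n) * (n * n)"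
    by linarith
  then have "5 * (n * n) + 3 \<le> n ^ 4"
    by (simp add: power4_eq_xxxx mult.assoc)
  then have "(5 * (n * n) + 3) * U \<le> n ^ 4 * U"
    by (rule mult_right_mono) simp
  then show ?thesis
    by (simp add: algebra_simps)
qed

context
  fixes M
  assumes M: "M \<in> ted_mappings F G"
begin

lemma M_nodes: "x \<in> M \<Longrightarrow> fst x \<in> nodes F" "x \<in> M \<Longrightarrow> snd x \<in> nodes G"
  using ted_mappingsD(1)[OF M] by auto

lemma finite_M: "finite M"
  using ted_mappingsD(1)[OF M] by (rule finite_subset) (simp add: finite_nodes)

lemmas M_rel = ted_mappingsD(2-4)[OF M]

text \<open>All contributing pairs contain the root of the second tree, and a mapping uses a node at
  most once.\<close>

lemma sum_root: "sum (pair_gain (gain_root n L)) M = 0 \<or>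
  (\<exists>p. p < n \<and> (down p [], []) \<in> M \<and>
    sum (pair_gain (gain_root n L)) M = 2 * L * p)"
proof -
  have pair: "\<exists>p. p < n \<and> x = (down p [], []) \<and>
      pair_gain (gain_root n L) x = 2 * L * p"
    if "x \<in> M" "pair_gain (gain_root n L) x \<noteq> 0" for x
    by (rule gain_root_nonzero[OF M_nodes(1) refl M_nodes(2) refl, OF that(1,1,2)])
      (auto simp: prod_eq_iff simp del: down.simps)
  have "x = y" if xy: "x \<in> M" "y \<in> M"
    "pair_gain (gain_root n L) x \<noteq> 0" "pair_gain (gain_root n L) y \<noteq> 0" for x y
  proof -
    obtain p where x: "x = (down p [], [])"
      using pair[OF xy(1,3)] by blast
    obtain p' where y: "y = (down p' [], [])"
      using pair[OF xy(2,4)] by blast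
    show ?thesis
      using M_rel[OF xy(1,2)[unfolded x y]] M_rel[OF xy(2,1)[unfolded x y]] unfolding x y
      by simp
  qed
  then have "sum (pair_gain (gain_root n L)) M = 0 \<or>
    (\<exists>x \<in> M. pair_gain (gain_root n L) x \<noteq> 0 \<and>
      sum (pair_gain (gain_root n L)) M = pair_gain (gain_root n L) x)"
    by (rule sum_at_most_one[OF finite_M])
  then show ?thesis
  proof (elim disjE bexE conjE)
    fix x assume x: "x \<in> M" "pair_gain (gain_root n L) x \<noteq> 0"
      "sum (pair_gain (gain_root n L)) M = pair_gain (gain_root n L) x"
    show ?thesis
      using pair[OF x(1,2)] x(1) unfolding x(3) by blast
  qed simp
qed

text \<open>The nodes of contributing pairs are comparable by ancestry in the first tree, where they
  lie on the spine, and incomparable in the second, where they are leaves. Hence there are no two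
  such pairs. For \<open>sum_jk\<close> and \<open>sum_ik\<close> the argument is the same with the
  trees exchanged.\<close>

lemma sum_ij: "sum (pair_gain (gain_ij n L H W)) M = 0 \<or>
  (\<exists>i j. i < n \<and> j < n \<and> (down (n + i) [], 0 # down j [2]) \<in> M \<and>
    int (sum (pair_gain (gain_ij n L H W)) M) = int H + int L * int j - int L * int i - int (W i j))"
proof -
  have pair: "\<exists>i j. i < n \<and> j < n \<and> x = (down (n + i) [], 0 # down j [2]) \<and>
      int (pair_gain (gain_ij n L H W) x) = int H + int L * int j - int L * int i - int (W i j)"
    if "x \<in> M" "pair_gain (gain_ij n L H W) x \<noteq> 0" for x
    by (rule gain_ij_nonzero[OF M_nodes(1) refl M_nodes(2) refl, OF that(1,1,2)])
      (auto simp: prod_eq_iff simp del: down.simps)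
  have "x = y" if xy: "x \<in> M" "y \<in> M"
    "pair_gain (gain_ij n L H W) x \<noteq> 0" "pair_gain (gain_ij n L H W) y \<noteq> 0" for x y
  proof -
    obtain i j where x: "x = (down (n + i) [], 0 # down j [2])"
      using pair[OF xy(1,3)] by blast
    obtain i' j' where y: "y = (down (n + i') [], 0 # down j' [2])"
      using pair[OF xy(2,4)] by blast
    show ?thesis
      using M_rel[OF xy(1,2)[unfolded x y]] M_rel[OF xy(2,1)[unfolded x y]] unfolding x y
      by simp
  qed
  then have "sum (pair_gain (gain_ij n L H W)) M = 0 \<or>
    (\<exists>x \<in> M. pair_gain (gain_ij n L H W) x \<noteq> 0 \<and>
      sum (pair_gain (gain_ij n L H W)) M = pair_gain (gain_ij n L H W) x)"
    by (rule sum_at_most_one[OF finite_M])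
  then show ?thesis
  proof (elim disjE bexE conjE)
    fix x assume x: "x \<in> M" "pair_gain (gain_ij n L H W) x \<noteq> 0"
      "sum (pair_gain (gain_ij n L H W)) M = pair_gain (gain_ij n L H W) x"
    show ?thesis
      using pair[OF x(1,2)] x(1) unfolding x(3) by blast
  qed simp
qed

lemma sum_jk: "sum (pair_gain (gain_jk n L H W)) M = 0 \<or>
  (\<exists>j k. j < n \<and> k < n \<and> (down k [0], 0 # down (Suc j) []) \<in> M \<and>
    int (sum (pair_gain (gain_jk n L H W)) M) = int H - int L * int k - int L * int j - int (W j k))"
proof -
  have pair: "\<exists>j k. j < n \<and> k < n \<and> x = (down k [0], 0 # down (Suc j) []) \<and>
      int (pair_gain (gain_jk n L H W) x) = int H - int L * int k - int L * int j - int (W j k)"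
    if "x \<in> M" "pair_gain (gain_jk n L H W) x \<noteq> 0" for x
    by (rule gain_jk_nonzero[OF M_nodes(1) refl M_nodes(2) refl, OF that(1,1,2)])
      (auto simp: prod_eq_iff simp del: down.simps)
  have "x = y" if xy: "x \<in> M" "y \<in> M"
    "pair_gain (gain_jk n L H W) x \<noteq> 0" "pair_gain (gain_jk n L H W) y \<noteq> 0" for x y
  proof -
    obtain j k where x: "x = (down k [0], 0 # down (Suc j) [])"
      using pair[OF xy(1,3)] by blast
    obtain j' k' where y: "y = (down k' [0], 0 # down (Suc j') [])"
      using pair[OF xy(2,4)] by blast
    show ?thesis
      using M_rel[OF xy(1,2)[unfolded x y]] M_rel[OF xy(2,1)[unfolded x y]] unfolding x y
      by (simp del: down.simps)
  qed
  then have "sum (pair_gain (gain_jk n L H W)) M = 0 \<or>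
    (\<exists>x \<in> M. pair_gain (gain_jk n L H W) x \<noteq> 0 \<and>
      sum (pair_gain (gain_jk n L H W)) M = pair_gain (gain_jk n L H W) x)"
    by (rule sum_at_most_one[OF finite_M])
  then show ?thesis
  proof (elim disjE bexE conjE)
    fix x assume x: "x \<in> M" "pair_gain (gain_jk n L H W) x \<noteq> 0"
      "sum (pair_gain (gain_jk n L H W)) M = pair_gain (gain_jk n L H W) x"
    show ?thesis
      using pair[OF x(1,2)] x(1) unfolding x(3) by blast
  qed simp
qed

lemma sum_ik: "sum (pair_gain (gain_ik n L H W)) M = 0 \<or>
  (\<exists>i k. i < n \<and> k < n \<and> (down k [2], 1 # down i []) \<in> M \<and>
    int (sum (pair_gain (gain_ik n L H W)) M) = int H - int L * int k - int L * int i - int (W i k))"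
proof -
  have pair: "\<exists>i k. i < n \<and> k < n \<and> x = (down k [2], 1 # down i []) \<and>
      int (pair_gain (gain_ik n L H W) x) = int H - int L * int k - int L * int i - int (W i k)"
    if "x \<in> M" "pair_gain (gain_ik n L H W) x \<noteq> 0" for x
    by (rule gain_ik_nonzero[OF M_nodes(1) refl M_nodes(2) refl, OF that(1,1,2)])
      (auto simp: prod_eq_iff simp del: down.simps)
  have "x = y" if xy: "x \<in> M" "y \<in> M"
    "pair_gain (gain_ik n L H W) x \<noteq> 0" "pair_gain (gain_ik n L H W) y \<noteq> 0" for x y
  proof -
    obtain i k where x: "x = (down k [2], 1 # down i [])"
      using pair[OF xy(1,3)] by blast
    obtain i' k' where y: "y = (down k' [2], 1 # down i' [])"
      using pair[OF xy(2,4)] by blast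
    show ?thesis
      using M_rel[OF xy(1,2)[unfolded x y]] M_rel[OF xy(2,1)[unfolded x y]] unfolding x y
      by simp
  qed
  then have "sum (pair_gain (gain_ik n L H W)) M = 0 \<or>
    (\<exists>x \<in> M. pair_gain (gain_ik n L H W) x \<noteq> 0 \<and>
      sum (pair_gain (gain_ik n L H W)) M = pair_gain (gain_ik n L H W) x)"
    by (rule sum_at_most_one[OF finite_M])
  then show ?thesis
  proof (elim disjE bexE conjE)
    fix x assume x: "x \<in> M" "pair_gain (gain_ik n L H W) x \<noteq> 0"
      "sum (pair_gain (gain_ik n L H W)) M = pair_gain (gain_ik n L H W) x"
    show ?thesis
      using pair[OF x(1,2)] x(1) unfolding x(3) by blast
  qed simp
qed

text \<open>This group may contain many pairs. They all have the same gain, so only their number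
  matters.\<close>

lemma sum_link:
  obtains A where "A \<subseteq> M" "sum (pair_gain (gain_link n L)) M = 2 * L * card A"
    "\<And>x. x \<in> A \<Longrightarrow> \<exists>p q. p < n \<and> q < n \<and> x = (down (n + p) [2], 1 # down q [0])"
proof -
  define A where "A = {x \<in> M. pair_gain (gain_link n L) x \<noteq> 0}"
  have A: "(\<exists>p q. p < n \<and> q < n \<and> x = (down (n + p) [2], 1 # down q [0])) \<and>
      pair_gain (gain_link n L) x = 2 * L" if "x \<in> A" for x
  proof -
    have x: "x \<in> M" "pair_gain (gain_link n L) x \<noteq> 0"
      using that by (auto simp: A_def)
    show ?thesis
      by (rule gain_link_nonzero[OF M_nodes(1) refl M_nodes(2) refl, OF x(1,1,2)])
        (auto simp: prod_eq_iff)
  qed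
  have "sum (pair_gain (gain_link n L)) M = sum (pair_gain (gain_link n L)) A"
    unfolding A_def by (intro sum.mono_neutral_right) (auto simp: finite_M)
  also have "\<dots> = 2 * L * card A"
    using A by simp
  finally show thesis
    using that[of A] A unfolding A_def by blast
qed

end

text \<open>If one of the three weighted pairs is missing, a term \<open>H\<close> is lost for good.
  Otherwise five inequalities hold between the indices, the root position \<open>p\<close> and the
  number of link pairs, and every unit of slack in them costs \<open>L\<close>.\<close>

lemma gain_sum_le:
  assumes M: "M \<in> ted_mappings F G"
  shows "int (sum (pair_gain (gain n L H W)) M) \<le> 3 * int H - int (min_triangle_weight n w)"
proof -
  define r where "r = sum (pair_gain (gain_root n L)) M"
  define s1 where "s1 = sum (pair_gain (gain_ij n L H W)) M"
  define s2 where "s2 = sum (pair_gain (gain_jk n L H W)) M"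
  define s3 where "s3 = sum (pair_gain (gain_ik n L H W)) M"
  have total: "sum (pair_gain (gain n L H W)) M =
    r + s1 + s2 + s3 + sum (pair_gain (gain_link n L)) M"
    by (simp add: gain_def sum.distrib r_def s1_def s2_def s3_def)
  obtain A where A: "A \<subseteq> M" "sum (pair_gain (gain_link n L)) M = 2 * L * card A"
    and A_shape: "\<And>x. x \<in> A \<Longrightarrow> \<exists>p q. p < n \<and> q < n \<and> x = (down (n + p) [2], 1 # down q [0])"
    using sum_link[OF M] by blast
  \<comment> \<open>A mapping is injective in each coordinate, so a bound on the indices in either
    coordinate bounds the number of link pairs.\<close>
  have card_fst: "card A \<le> c" if c: "\<And>p q. (down (n + p) [2], 1 # down q [0]) \<in> A \<Longrightarrow> p < c" for c
  proof -
    have "inj_on fst A"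
      using A(1) ted_mappingsD(2)[OF M] by (fastforce simp: inj_on_def)
    then have "card A = card (fst ` A)"
      by (simp add: card_image)
    also have "\<dots> \<le> card ((\<lambda>p. down (n + p) [2]) ` {..<c})"
      using A_shape c by (intro card_mono) fastforce+
    also have "\<dots> \<le> c"
      using card_image_le[of "{..<c}"] by simp
    finally show ?thesis .
  qed
  have card_snd: "card A \<le> c" if c: "\<And>p q. (down (n + p) [2], 1 # down q [0]) \<in> A \<Longrightarrow> q < c" for c
  proof -
    have "inj_on snd A"
      using A(1) ted_mappingsD(2)[OF M] by (fastforce simp: inj_on_def)
    then have "card A = card (snd ` A)"
      by (simp add: card_image)
    also have "\<dots> \<le> card ((\<lambda>q. 1 # down q [0]) ` {..<c})"
      using A_shape c by (intro card_mono) fastforce+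
    also have "\<dots> \<le> c"
      using card_image_le[of "{..<c}"] by simp
    finally show ?thesis .
  qed
  have "card A \<le> n"
    by (rule card_fst) (use A_shape in fastforce)
  then have link_le: "sum (pair_gain (gain_link n L)) M \<le> 2 * (L * n)"
    unfolding A(2) by simp
  have r_le: "r \<le> 2 * (L * n)"
    using sum_root[OF M] unfolding r_def[symmetric] by auto
  have s1_le: "s1 \<le> H + L * n"
  proof (cases "s1 = 0")
    case False
    then obtain i j where ij: "j < n" "int s1 = int H + int L * int j - int L * int i - int (W i j)"
      using sum_ij[OF M] unfolding s1_def[symmetric] by blast
    have "0 \<le> int L * int i"
      by simp
    then have "int s1 \<le> int (H + L * j)"
      unfolding of_nat_add of_nat_mult[of L j] using ij(2) by linarith
    moreover have "L * j \<le> L * n"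
      using ij(1) by simp
    ultimately show ?thesis
      by linarith
  qed simp
  have s2_le: "s2 \<le> H"
  proof (cases "s2 = 0")
    case False
    then obtain i k where "int s2 = int H - int L * int k - int L * int i - int (W i k)"
      using sum_jk[OF M] unfolding s2_def[symmetric] by blast
    moreover have "0 \<le> int L * int k" "0 \<le> int L * int i"
      by simp_all
    ultimately show ?thesis
      by linarith
  qed simp
  have s3_le: "s3 \<le> H"
  proof (cases "s3 = 0")
    case False
    then obtain i k where "int s3 = int H - int L * int k - int L * int i - int (W i k)"
      using sum_ik[OF M] unfolding s3_def[symmetric] by blast
    moreover have "0 \<le> int L * int k" "0 \<le> int L * int i"
      by simp_all
    ultimately show ?thesis
      by linarith
  qed simp
  note bounds = r_le s1_le s2_le s3_le link_le
  show ?thesis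
  proof (cases "s1 = 0 \<or> s2 = 0 \<or> s3 = 0")
    case True
    \<comment> \<open>At most two terms \<open>H\<close> remain. The root pair, the slope of
      \<open>j\<close> and the link pairs add at most 2, 1 and 2 times \<open>L * n\<close>.\<close>
    then have "sum (pair_gain (gain n L H W)) M \<le> 2 * H + 5 * (L * n)"
      using bounds total by (elim disjE; linarith)
    then show ?thesis
      using H_large min_triangle_le_U by linarith
  next
    case False
    obtain i1 j1 where ij: "i1 < n" "j1 < n" "(down (n + i1) [], 0 # down j1 [2]) \<in> M"
      "int s1 = int H + int L * int j1 - int L * int i1 - int (W i1 j1)"
      using sum_ij[OF M] False unfolding s1_def[symmetric] by blast
    obtain j2 k2 where jk: "j2 < n" "k2 < n" "(down k2 [0], 0 # down (Suc j2) []) \<in> M"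
      "int s2 = int H - int L * int k2 - int L * int j2 - int (W j2 k2)"
      using sum_jk[OF M] False unfolding s2_def[symmetric] by blast
    obtain i3 k3 where ik: "i3 < n" "k3 < n" "(down k3 [2], 1 # down i3 []) \<in> M"
      "int s3 = int H - int L * int k3 - int L * int i3 - int (W i3 k3)"
      using sum_ik[OF M] False unfolding s3_def[symmetric] by blast
    \<comment> \<open>The matched spine node must be an ancestor of both leaves \<open>k2\<close>
      and \<open>k3\<close>, because the root is an ancestor of their partners. If the root
      contributes nothing, \<open>p = 0\<close> gives the right value and satisfies both
      bounds.\<close>
    obtain p where p: "p \<le> k2" "p \<le> k3" "r = 2 * L * p"
    proof (cases "r = 0")
      case True
      then show thesis
        using that[of 0] by simp
    next
      case False
      then obtain p where p: "(down p [], []) \<in> M" "r = 2 * L * p"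
        using sum_root[OF M] unfolding r_def[symmetric] by blast
      then show thesis
        using that[of p] ted_mappingsD(3)[OF M p(1) jk(3)] ted_mappingsD(3)[OF M p(1) ik(3)]
        by simp
    qed
    \<comment> \<open>Left leaf \<open>k2\<close> of the upper half precedes spine node
      \<open>n + i1\<close>. So spine node \<open>Suc j2\<close> precedes right leaf
      \<open>j1\<close>, which means \<open>j1 < Suc j2\<close>.\<close>
    have "j1 \<le> j2"
      using ted_mappingsD(4)[OF M jk(3) ij(3)] jk(2) by (simp del: down.simps)
    \<comment> \<open>The first spine of the second tree lies to the left of the second. So spine
      node \<open>n + i1\<close> lies to the left of right leaf \<open>n + p\<close>, which must
      then be attached above it.\<close>
    have "card A \<le> i1"
    proof (rule card_fst)
      fix p q assume "(down (n + p) [2], 1 # down q [0]) \<in> A"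
      then show "p < i1"
        using ted_mappingsD(4)[OF M ij(3)] A(1) by fastforce
    qed
    \<comment> \<open>A right leaf of the lower half lies to the left of right leaf
      \<open>k3\<close> of the upper half. So left leaf \<open>q\<close> lies to the left of spine
      node \<open>i3\<close>, which means \<open>q < i3\<close>.\<close>
    have "card A \<le> i3"
    proof (rule card_snd)
      fix p q assume a: "(down (n + p) [2], 1 # down q [0]) \<in> A"
      then have "(down (n + p) [2], 1 # down q [0]) \<in> M"
        using A(1) by blast
      from ted_mappingsD(4)[OF M this ik(3)] show "q < i3"
        using ik(2) by simp
    qed
    \<comment> \<open>The slopes in the five groups add up to exactly \<open>- L * d\<close>, where
      \<open>d\<close> is the total slack. The natural subtractions are exact by the inequalities
      just shown.\<close>
    define d where "d = (j2 - j1) + (k2 - p) + (k3 - p) + (i1 - card A) + (i3 - card A)"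
    have d: "int d = int j2 - int j1 + (int k2 - int p) + (int k3 - int p) +
        (int i1 - int (card A)) + (int i3 - int (card A))"
      using \<open>j1 \<le> j2\<close> p \<open>card A \<le> i1\<close> \<open>card A \<le> i3\<close> by (simp add: d_def)
    have total': "int (sum (pair_gain (gain n L H W)) M) =
      3 * int H - int L * int d - int (W i1 j1 + W j2 k2 + W i3 k3)"
      unfolding total A(2) p(3) of_nat_add ij(4) jk(4) ik(4) d by (simp add: algebra_simps)
    show ?thesis
    proof (cases "d = 0")
      case True
      then have "j1 = j2" "k2 = k3" "i1 = i3"
        using \<open>j1 \<le> j2\<close> p \<open>card A \<le> i1\<close> \<open>card A \<le> i3\<close> by (auto simp: d_def)
      then show ?thesis
        using total' True min_triangle_le[OF ij(1) jk(1,2)] by simp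
    next
      case False
      \<comment> \<open>One unit of slack costs at least \<open>L\<close>, hence at least the weight
        of a lightest triangle, even if the three weights used were 0.\<close>
      then have "L * 1 \<le> L * d"
        by (intro mult_left_mono) auto
      then have "int L \<le> int L * int d"
        by (metis mult.right_neutral of_nat_le_iff of_nat_mult)
      then show ?thesis
        using total' min_triangle_le_U U_le_L by linarith
    qed
  qed
qed

section \<open>A mapping that attains the bound\<close>

lemma label_F:
  "t \<le> 2 * n \<Longrightarrow> label_at F (down t []) = lab 0 t"
  "t < 2 * n \<Longrightarrow> label_at F (down t [0]) = lab 1 t"
  "t < 2 * n \<Longrightarrow> label_at F (down t [2]) = lab 2 t"
  unfolding tree_F_def using label_at_comb[of t "2 * n" 0] by (simp_all only: add_0)

lemma label_G:
  "label_at G [] = lab 6 0"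
  "t \<le> n \<Longrightarrow> label_at G (0 # down t []) = lab 0 t"
  "t < n \<Longrightarrow> label_at G (0 # down t [2]) = lab 2 t"
  "t \<le> n \<Longrightarrow> label_at G (1 # down t []) = lab 3 t"
  "t < n \<Longrightarrow> label_at G (1 # down t [0]) = lab 4 t"
  using label_at_comb[of t n 0] label_at_comb[of t n 3]
  by (simp_all add: tree_G_def lab_def)

text \<open>For a lightest triangle \<open>i\<close>, \<open>j\<close>, \<open>k\<close>, both
  occurrences of each index are chosen equal, the root is matched with spine node \<open>k\<close>,
  and there are \<open>i\<close> link pairs. All five inequalities are then tight.\<close>

lemma gain_sum_attained:
  obtains M where "M \<in> ted_mappings F G"
    "int (sum (pair_gain (gain n L H W)) M) = 3 * int H - int (min_triangle_weight n w)"
proof -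
  obtain i j k where ijk: "i < n" "j < n" "k < n"
    and min: "min_triangle_weight n w = W i j + W j k + W i k"
    using min_triangle_attained by blast
  \<comment> \<open>The indices run in opposite directions because deeper right leaves lie further
    left, while deeper left leaves lie further right.\<close>
  define f where "f = (\<lambda>p. (down (n + p) [2], (1::nat) # down (i - 1 - p) [0]))"
  define M where "M = {(down k [], []), (down k [0], 0 # down (Suc j) []),
    (down (n + i) [], 0 # down j [2]), (down k [2], 1 # down i [])} \<union> f ` {..<i}"
  have "M \<subseteq> nodes F \<times> nodes G"
    using ijk by (auto simp: M_def f_def tree_F_def tree_G_def nodes_comb nodes_Node2
        simp del: down.simps)
  moreover have "\<forall>x \<in> M. \<forall>y \<in> M. (fst x = fst y \<longleftrightarrow> snd x = snd y) \<and>
      (ancestor (fst x) (fst y) \<longleftrightarrow> ancestor (snd x) (snd y)) \<and>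
      (left_of (fst x) (fst y) \<longleftrightarrow> left_of (snd x) (snd y))"
    using ijk by (auto simp: M_def f_def simp del: down.simps)
  ultimately have M: "M \<in> ted_mappings F G"
    unfolding ted_mappings_def by (simp add: case_prod_unfold)
  have W_le: "W i j + W j k + W i k \<le> U"
    using min min_triangle_le_U by simp
  have L_le: "L * i \<le> L * n" "L * j \<le> L * n" "L * k \<le> L * n"
    using ijk by simp_all
  \<comment> \<open>These bounds exclude truncation in the three weighted gains.\<close>
  have le: "L * k + L * j + W j k \<le> H" "L * i + W i j \<le> H + L * j" "L * k + L * i + W i k \<le> H"
    using L_le W_le H_large by linarith+
  have gain_f: "pair_gain (gain n L H W) (f p) = 2 * L" if "p < i" for p
  proof -
    have "label_at G (snd (f p)) = lab 4 (i - 1 - p)"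
      unfolding f_def snd_conv using that ijk by (intro label_G(5)) linarith
    then show ?thesis
      using that ijk by (simp add: f_def label_F gain_def gain_defs)
  qed
  have g: "int (pair_gain (gain n L H W) (down k [], [])) = 2 * int L * int k"
    "int (pair_gain (gain n L H W) (down k [0], 0 # down (Suc j) [])) =
      int H - int L * int k - int L * int j - int (W j k)"
    "int (pair_gain (gain n L H W) (down (n + i) [], 0 # down j [2])) =
      int H + int L * int j - int L * int i - int (W i j)"
    "int (pair_gain (gain n L H W) (down k [2], 1 # down i [])) =
      int H - int L * int k - int L * int i - int (W i k)"
  proof -
    have "pair_gain (gain n L H W) (down k [], []) = 2 * L * k"
      using ijk by (simp add: label_F label_G label_G[unfolded One_nat_def] gain_def gain_defs
          del: down.simps label_at.simps)
    then show "int (pair_gain (gain n L H W) (down k [], [])) = 2 * int L * int k"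
      by simp
    have "pair_gain (gain n L H W) (down k [0], 0 # down (Suc j) []) = H - (L * k + L * j + W j k)"
      using ijk by (simp add: label_F label_G label_G[unfolded One_nat_def] gain_def gain_defs
          del: down.simps label_at.simps)
    then show "int (pair_gain (gain n L H W) (down k [0], 0 # down (Suc j) [])) =
      int H - int L * int k - int L * int j - int (W j k)"
      by (simp only: of_nat_diff[OF le(1)] of_nat_add of_nat_mult)
    have "pair_gain (gain n L H W) (down (n + i) [], 0 # down j [2]) = H + L * j - (L * i + W i j)"
      using ijk by (simp add: label_F label_G label_G[unfolded One_nat_def] gain_def gain_defs
          del: down.simps label_at.simps)
    then show "int (pair_gain (gain n L H W) (down (n + i) [], 0 # down j [2])) =
      int H + int L * int j - int L * int i - int (W i j)"
      by (simp only: of_nat_diff[OF le(2)] of_nat_add of_nat_mult)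
    have "pair_gain (gain n L H W) (down k [2], 1 # down i []) = H - (L * k + L * i + W i k)"
      using ijk by (simp add: label_F label_G label_G[unfolded One_nat_def] gain_def gain_defs
          del: down.simps label_at.simps)
    then show "int (pair_gain (gain n L H W) (down k [2], 1 # down i [])) =
      int H - int L * int k - int L * int i - int (W i k)"
      by (simp only: of_nat_diff[OF le(3)] of_nat_add of_nat_mult)
  qed
  have inj: "inj_on f {..<i}"
    by (auto simp: f_def inj_on_def)
  have sum_M: "sum h M = h (down k [], []) + h (down k [0], 0 # down (Suc j) []) +
      h (down (n + i) [], 0 # down j [2]) + h (down k [2], 1 # down i []) + (\<Sum>p<i. h (f p))"
    for h :: "nat list \<times> nat list \<Rightarrow> nat"
    unfolding M_def using ijk
    by (subst sum.union_disjoint)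
      (auto simp: sum.reindex[OF inj] comp_def, auto simp: f_def)
  have "(\<Sum>p<i. pair_gain (gain n L H W) (f p)) = 2 * L * i"
    using gain_f by simp
  then have "int (sum (pair_gain (gain n L H W)) M) = 2 * int L * int k +
    (int H - int L * int k - int L * int j - int (W j k)) +
    (int H + int L * int j - int L * int i - int (W i j)) +
    (int H - int L * int k - int L * int i - int (W i k)) + int (2 * L * i)"
    by (simp only: sum_M of_nat_add g)
  then have "int (sum (pair_gain (gain n L H W)) M) =
    3 * int H - int (min_triangle_weight n w)"
    by (simp add: min algebra_simps)
  then show thesis
    using that M by blast
qed

text \<open>The class of \<open>b\<close> allows at most one of the five summands to be nonzero, and
  each is at most \<open>2 * H\<close>. Consequently the subtraction in the matching costs is
  exact.\<close>

lemma gain_le: "gain n L H W a b \<le> 2 * H"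
proof -
  have L_le: "L * x \<le> H" if "x < n" for x
  proof -
    have "L * x \<le> L * n"
      using that by simp
    then show ?thesis
      using H_large by linarith
  qed
  have "H + L * (b div 7) - x \<le> 2 * H" if "b div 7 < n" for x
    using L_le[OF that] diff_le_self[of "H + L * (b div 7)" x] by linarith
  then have b: "gain_root n L a b \<le> 2 * H" "gain_ij n L H W a b \<le> 2 * H" "gain_jk n L H W a b \<le> 2 * H"
    "gain_ik n L H W a b \<le> 2 * H" "gain_link n L a b \<le> 2 * H"
    using L_le[of "a div 7"] L_le[of "b div 7"] L_le[of 1] three_le_n
    by (auto simp: gain_defs)
  have z: "gain_root n L a b \<noteq> 0 \<Longrightarrow> b mod 7 = 6" "gain_ij n L H W a b \<noteq> 0 \<Longrightarrow> b mod 7 = 2"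
    "gain_jk n L H W a b \<noteq> 0 \<Longrightarrow> b mod 7 = 0" "gain_ik n L H W a b \<noteq> 0 \<Longrightarrow> b mod 7 = 3"
    "gain_link n L a b \<noteq> 0 \<Longrightarrow> b mod 7 = 4"
    by (auto simp: gain_defs split: if_splits)
  consider "gain_root n L a b \<noteq> 0" | "gain_ij n L H W a b \<noteq> 0" | "gain_jk n L H W a b \<noteq> 0"
    | "gain_ik n L H W a b \<noteq> 0" | "gain_link n L a b \<noteq> 0" | "gain n L H W a b = 0"
    unfolding gain_def by fastforce
  then show ?thesis
  proof cases
    case 1
    then show ?thesis unfolding gain_def using b(1) z(2-5) z(1)[OF 1] by fastforce
  next
    case 2
    then show ?thesis unfolding gain_def using b(2) z(1,3-5) z(2)[OF 2] by fastforce
  next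
    case 3
    then show ?thesis unfolding gain_def using b(3) z(1,2,4,5) z(3)[OF 3] by fastforce
  next
    case 4
    then show ?thesis unfolding gain_def using b(4) z(1-3,5) z(4)[OF 4] by fastforce
  next
    case 5
    then show ?thesis unfolding gain_def using b(5) z(1-4) z(5)[OF 5] by fastforce
  qed simp
qed

text \<open>The trees have \<open>12 * n + 4\<close> nodes in total, and an optimal mapping gains
  \<open>3 * H\<close> minus the weight of a lightest triangle.\<close>

theorem ted_gadget: "ted (gadget n U w) = H * (12 * n + 1) + min_triangle_weight n w"
proof -
  define cost where
    "cost = mapping_cost (\<lambda>_. H) (\<lambda>a b. 2 * H - gain n L H W a b) F G"
  have cost: "int (cost M) = int H * (12 * int n + 4) - int (sum (pair_gain (gain n L H W)) M)"
    if "M \<in> ted_mappings F G" for M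
  proof -
    have "2 * int H - int (2 * H - gain n L H W a b) = int (gain n L H W a b)" for a b
      using gain_le[of a b] by (simp add: of_nat_diff del: of_nat_mult of_nat_power)
    then have "(\<Sum>(u, v) \<in> M. 2 * int H -
        int (2 * H - gain n L H W (label_at F u) (label_at G v))) =
      int (sum (pair_gain (gain n L H W)) M)"
      by (simp only: case_prod_unfold of_nat_sum)
    then show ?thesis
      unfolding cost_def mapping_cost_gain[OF that] tree_size_F tree_size_G
      by (simp add: algebra_simps)
  qed
  have "Min (cost ` ted_mappings F G) = H * (12 * n + 1) + min_triangle_weight n w"
  proof (rule Min_eqI)
    show "finite (cost ` ted_mappings F G)"
      by (simp add: ted_mappings_finite_nonempty)
  next
    fix y assume "y \<in> cost ` ted_mappings F G"
    then obtain M where M: "M \<in> ted_mappings F G" "y = cost M"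
      by blast
    have "int (H * (12 * n + 1) + min_triangle_weight n w) \<le> int y"
      using cost[OF M(1)] gain_sum_le[OF M(1)] by (simp add: M(2) algebra_simps)
    then show "H * (12 * n + 1) + min_triangle_weight n w \<le> y"
      by linarith
  next
    obtain M where M: "M \<in> ted_mappings F G"
      "int (sum (pair_gain (gain n L H W)) M) = 3 * int H - int (min_triangle_weight n w)"
      using gain_sum_attained by blast
    have "int (cost M) = int (H * (12 * n + 1) + min_triangle_weight n w)"
      using cost[OF M(1)] M(2) by (simp add: algebra_simps)
    then show "H * (12 * n + 1) + min_triangle_weight n w \<in> cost ` ted_mappings F G"
      using M(1) by (metis image_eqI of_nat_eq_iff)
  qed
  then show ?thesis
    by (simp add: ted_def edit_distance_def gadget_def cost_def)
qed

end

section \<open>Compiling expressions and loops to the word RAM\<close>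

datatype expr =
    Cst nat
  | Var reg
  | Bin arith_op expr expr
  | Mem expr
  | Cond expr expr expr expr

primrec val :: "(nat \<Rightarrow> nat) \<Rightarrow> (nat \<Rightarrow> nat) \<Rightarrow> expr \<Rightarrow> nat" where
  "val m \<rho> (Cst a) = a"
| "val m \<rho> (Var x) = \<rho> x"
| "val m \<rho> (Bin f a b) = apply_op f (val m \<rho> a) (val m \<rho> b)"
| "val m \<rho> (Mem a) = m (val m \<rho> a)"
| "val m \<rho> (Cond a b c d) = (if val m \<rho> a < val m \<rho> b then val m \<rho> c else val m \<rho> d)"

text \<open>Variables and loaded words must also be below \<open>B\<close>, so that every safe value
  can be copied by an addition. Of a \<open>Cond\<close> only the branch taken is checked, so tests
  can protect the arithmetic behind them.\<close>

primrec safe :: "nat \<Rightarrow> (nat \<Rightarrow> nat) \<Rightarrow> (nat \<Rightarrow> nat) \<Rightarrow> expr \<Rightarrow> bool" where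
  "safe B m \<rho> (Cst a) \<longleftrightarrow> a < B"
| "safe B m \<rho> (Var x) \<longleftrightarrow> \<rho> x < B"
| "safe B m \<rho> (Bin f a b) \<longleftrightarrow>
     safe B m \<rho> a \<and> safe B m \<rho> b \<and> apply_op f (val m \<rho> a) (val m \<rho> b) < B"
| "safe B m \<rho> (Mem a) \<longleftrightarrow> safe B m \<rho> a \<and> m (val m \<rho> a) < B"
| "safe B m \<rho> (Cond a b c d) \<longleftrightarrow> safe B m \<rho> a \<and> safe B m \<rho> b \<and>
     (if val m \<rho> a < val m \<rho> b then safe B m \<rho> c else safe B m \<rho> d)"

primrec vars_below :: "nat \<Rightarrow> expr \<Rightarrow> bool" where
  "vars_below r (Cst a) \<longleftrightarrow> True"
| "vars_below r (Var x) \<longleftrightarrow> x < r"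
| "vars_below r (Bin f a b) \<longleftrightarrow> vars_below r a \<and> vars_below r b"
| "vars_below r (Mem a) \<longleftrightarrow> vars_below r a"
| "vars_below r (Cond a b c d) \<longleftrightarrow>
     vars_below r a \<and> vars_below r b \<and> vars_below r c \<and> vars_below r d"

text \<open>A bound that counts both branches of a \<open>Cond\<close> and so does not depend on the
  values of the variables.\<close>

primrec time :: "expr \<Rightarrow> nat" where
  "time (Cst a) = 1"
| "time (Var x) = 2"
| "time (Bin f a b) = time a + time b + 1"
| "time (Mem a) = time a + 1"
| "time (Cond a b c d) = time a + time b + time c + time d + 1"

text \<open>Registers above the target register serve as evaluation stack. The instruction set has
  no move, so a variable is added to a register holding 0.\<close>

primrec compile :: "expr \<Rightarrow> reg \<Rightarrow> com" where
  "compile (Cst a) r = SetConst r a"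
| "compile (Var x) r = Seq (SetConst r 0) (Arith Plus r r x)"
| "compile (Bin f a b) r = Seq (compile a r) (Seq (compile b (Suc r)) (Arith f r r (Suc r)))"
| "compile (Mem a) r = Seq (compile a r) (Load r r)"
| "compile (Cond a b c d) r = Seq (compile a r) (Seq (compile b (Suc r))
     (IfLess r (Suc r) (compile c r) (compile d r)))"

lemma safe_val: "safe B m \<rho> e \<Longrightarrow> val m \<rho> e < B"
  by (induction e) (auto split: if_splits)

lemma vars_below_mono: "vars_below r e \<Longrightarrow> r \<le> r' \<Longrightarrow> vars_below r' e"
  by (induction e) auto

lemma val_cong: "vars_below r e \<Longrightarrow> \<forall>x<r. \<rho> x = \<rho>' x \<Longrightarrow> val m \<rho> e = val m \<rho>' e"
  by (induction e) auto

lemma safe_cong: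
  "vars_below r e \<Longrightarrow> \<forall>x<r. \<rho> x = \<rho>' x \<Longrightarrow> safe B m \<rho> e = safe B m \<rho>' e"
proof (induction e)
  case (Bin f a b)
  then show ?case
    using val_cong[of r a \<rho> \<rho>' m] val_cong[of r b \<rho> \<rho>' m] by simp
next
  case (Mem a)
  then show ?case
    using val_cong[of r a \<rho> \<rho>' m] by simp
next
  case (Cond a b c d)
  then show ?case
    using val_cong[of r a \<rho> \<rho>' m] val_cong[of r b \<rho> \<rho>' m] by simp
qed simp_all

text \<open>Preserving all registers below \<open>r\<close> keeps both the variables and the
  intermediate results further down the evaluation stack. The induction therefore has to range over
  all \<open>r\<close> and \<open>s\<close>.\<close>

lemma exec_compile:
  assumes "safe B (mem s) (regs s) e" "vars_below r e"
  shows "\<exists>t \<rho>. exec B (compile e r) s t (s\<lparr>regs := \<rho>\<rparr>) \<and> t \<le> time e \<and>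
    \<rho> r = val (mem s) (regs s) e \<and> (\<forall>x<r. \<rho> x = regs s x)"
  using assms
proof (induction e arbitrary: r s)
  case (Cst a)
  then have "exec B (compile (Cst a) r) s 1 (s\<lparr>regs := (regs s)(r := a)\<rparr>)"
    by (simp add: exec.SetConst del: One_nat_def)
  then show ?case
    by (intro exI[of _ 1] exI[of _ "(regs s)(r := a)"]) (simp del: fun_upd_apply, simp)
next
  case (Var x)
  let ?s = "s\<lparr>regs := (regs s)(r := 0)\<rparr>"
  have "exec B (SetConst r 0) s 1 ?s"
    using Var by (intro exec.SetConst) simp
  moreover have "exec B (Arith Plus r r x) ?s 1 (?s\<lparr>regs := (regs ?s)(r := regs s x)\<rparr>)"
    using Var by (intro exec.Arith) auto
  ultimately have "exec B (compile (Var x) r) s (1 + 1) (s\<lparr>regs := (regs s)(r := regs s x)\<rparr>)"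
    by (auto dest: exec.Seq)
  then show ?case
    by (intro exI[of _ "1 + 1"] exI[of _ "(regs s)(r := regs s x)"]) (simp del: fun_upd_apply, simp)
next
  case (Bin f a b)
  obtain t1 \<rho>1 where 1: "exec B (compile a r) s t1 (s\<lparr>regs := \<rho>1\<rparr>)" "t1 \<le> time a"
    "\<rho>1 r = val (mem s) (regs s) a" "\<forall>x<r. \<rho>1 x = regs s x"
    using Bin.IH(1)[of s r] Bin.prems by auto
  have b: "val (mem s) \<rho>1 b = val (mem s) (regs s) b" "safe B (mem s) \<rho>1 b"
    using val_cong[of r b \<rho>1 "regs s"] safe_cong[of r b \<rho>1 "regs s"] 1(4) Bin.prems by auto
  obtain t2 \<rho>2 where 2: "exec B (compile b (Suc r)) (s\<lparr>regs := \<rho>1\<rparr>) t2 (s\<lparr>regs := \<rho>2\<rparr>)"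
    "t2 \<le> time b" "\<rho>2 (Suc r) = val (mem s) (regs s) b" "\<forall>x<Suc r. \<rho>2 x = \<rho>1 x"
    using Bin.IH(2)[of "s\<lparr>regs := \<rho>1\<rparr>" "Suc r"] b Bin.prems vars_below_mono[of r b "Suc r"]
    by auto
  let ?v = "val (mem s) (regs s) (Bin f a b)"
  have "exec B (Arith f r r (Suc r)) (s\<lparr>regs := \<rho>2\<rparr>) 1
    ((s\<lparr>regs := \<rho>2\<rparr>)\<lparr>regs := (regs (s\<lparr>regs := \<rho>2\<rparr>))(r := ?v)\<rparr>)"
    using 1 2 Bin.prems by (intro exec.Arith) auto
  from exec.Seq[OF 1(1) exec.Seq[OF 2(1) this]]
  have "exec B (compile (Bin f a b) r) s (t1 + (t2 + 1)) (s\<lparr>regs := \<rho>2(r := ?v)\<rparr>)"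
    by simp
  then show ?case
    using 1 2 by (intro exI[of _ "t1 + (t2 + 1)"] exI[of _ "\<rho>2(r := ?v)"])
      (simp del: fun_upd_apply, simp)
next
  case (Mem a)
  obtain t1 \<rho>1 where 1: "exec B (compile a r) s t1 (s\<lparr>regs := \<rho>1\<rparr>)" "t1 \<le> time a"
    "\<rho>1 r = val (mem s) (regs s) a" "\<forall>x<r. \<rho>1 x = regs s x"
    using Mem.IH[of s r] Mem.prems by auto
  let ?v = "val (mem s) (regs s) (Mem a)"
  have "exec B (Load r r) (s\<lparr>regs := \<rho>1\<rparr>) 1 (s\<lparr>regs := \<rho>1(r := ?v)\<rparr>)"
    using exec.Load[of B r r "s\<lparr>regs := \<rho>1\<rparr>"] 1(3) by simp
  from exec.Seq[OF 1(1) this]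
  have "exec B (compile (Mem a) r) s (t1 + 1) (s\<lparr>regs := \<rho>1(r := ?v)\<rparr>)"
    by simp
  then show ?case
    using 1 by (intro exI[of _ "t1 + 1"] exI[of _ "\<rho>1(r := ?v)"])
      (simp del: fun_upd_apply, simp)
next
  case (Cond a b c d)
  obtain t1 \<rho>1 where 1: "exec B (compile a r) s t1 (s\<lparr>regs := \<rho>1\<rparr>)" "t1 \<le> time a"
    "\<rho>1 r = val (mem s) (regs s) a" "\<forall>x<r. \<rho>1 x = regs s x"
    using Cond.IH(1)[of s r] Cond.prems by auto
  have b: "val (mem s) \<rho>1 b = val (mem s) (regs s) b" "safe B (mem s) \<rho>1 b"
    using val_cong[of r b \<rho>1 "regs s"] safe_cong[of r b \<rho>1 "regs s"] 1(4) Cond.prems by auto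
  obtain t2 \<rho>2 where 2: "exec B (compile b (Suc r)) (s\<lparr>regs := \<rho>1\<rparr>) t2 (s\<lparr>regs := \<rho>2\<rparr>)"
    "t2 \<le> time b" "\<rho>2 (Suc r) = val (mem s) (regs s) b" "\<forall>x<Suc r. \<rho>2 x = \<rho>1 x"
    using Cond.IH(2)[of "s\<lparr>regs := \<rho>1\<rparr>" "Suc r"] b Cond.prems vars_below_mono[of r b "Suc r"]
    by auto
  \<comment> \<open>Naming the branch taken allows one argument for both outcomes of the
    test.\<close>
  define e where "e = (if val (mem s) (regs s) a < val (mem s) (regs s) b then c else d)"
  have e': "safe B (mem s) (regs s) e" "vars_below r e"
    using Cond.prems by (auto simp: e_def)
  have \<rho>2: "\<forall>x<r. \<rho>2 x = regs s x"
    using 1(4) 2(4) by simp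
  have e: "val (mem s) \<rho>2 e = val (mem s) (regs s) e" "safe B (mem s) \<rho>2 e"
    using val_cong[OF e'(2) \<rho>2] safe_cong[OF e'(2) \<rho>2] e'(1) by auto
  obtain t3 \<rho>3 where 3: "exec B (compile e r) (s\<lparr>regs := \<rho>2\<rparr>) t3 (s\<lparr>regs := \<rho>3\<rparr>)"
    "t3 \<le> time e" "\<rho>3 r = val (mem s) (regs s) e" "\<forall>x<r. \<rho>3 x = \<rho>2 x"
    using Cond.IH(3)[of "s\<lparr>regs := \<rho>2\<rparr>" r] Cond.IH(4)[of "s\<lparr>regs := \<rho>2\<rparr>" r] e e'(2)
    unfolding e_def by (auto split: if_splits)
  have "exec B (IfLess r (Suc r) (compile c r) (compile d r)) (s\<lparr>regs := \<rho>2\<rparr>) (Suc t3)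
    (s\<lparr>regs := \<rho>3\<rparr>)"
  proof (cases "val (mem s) (regs s) a < val (mem s) (regs s) b")
    case True
    then show ?thesis
      using 3(1) 1(3) 2(3,4) by (intro exec.IfTrue) (auto simp: e_def)
  next
    case False
    then show ?thesis
      using 3(1) 1(3) 2(3,4) by (intro exec.IfFalse) (auto simp: e_def)
  qed
  from exec.Seq[OF 1(1) exec.Seq[OF 2(1) this]]
  have "exec B (compile (Cond a b c d) r) s (t1 + (t2 + Suc t3)) (s\<lparr>regs := \<rho>3\<rparr>)"
    by simp
  moreover have "t1 + (t2 + Suc t3) \<le> time (Cond a b c d)"
    using 1(2) 2(2) 3(2) by (auto simp: e_def split: if_splits)
  ultimately show ?case
    using 3 \<rho>2 by (intro exI[of _ "t1 + (t2 + Suc t3)"] exI[of _ \<rho>3]) (auto simp: e_def)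
qed

section \<open>Assignments, output and counting loops\<close>

abbreviation nvars :: nat where "nvars \<equiv> 8"

text \<open>The value is computed in a scratch register before \<open>x\<close> is cleared, so
  \<open>e\<close> may mention \<open>x\<close>.\<close>

definition assign :: "reg \<Rightarrow> expr \<Rightarrow> com" where
  "assign x e = Seq (compile e nvars) (Seq (SetConst x 0) (Arith Plus x x nvars))"

primrec writes :: "expr list \<Rightarrow> com" where
  "writes [] = Skip"
| "writes (e # es) = Seq (Seq (compile e nvars) (Write nvars)) (writes es)"

text \<open>The counter is reset at the end, so that a loop leaves all variables unchanged.\<close>

definition for_loop :: "reg \<Rightarrow> reg \<Rightarrow> com \<Rightarrow> com" where
  "for_loop x h p =
     Seq (WhileLess x h (Seq p (assign x (Bin Plus (Var x) (Cst 1))))) (assign x (Cst 0))"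

text \<open>A Hoare triple with a time bound and the output appended, for programs that leave the
  memory unchanged. Only the variables are described, so the contents of the evaluation stack can be
  ignored in compositions.\<close>

definition runs ::
  "nat \<Rightarrow> (nat \<Rightarrow> nat) \<Rightarrow> com \<Rightarrow> (nat \<Rightarrow> nat) \<Rightarrow> nat \<Rightarrow> (nat \<Rightarrow> nat) \<Rightarrow> nat list \<Rightarrow> bool" where
  "runs B m p \<rho> T \<rho>' ys \<longleftrightarrow>
     (\<forall>s. (\<forall>x<nvars. regs s x = \<rho> x) \<and> mem s = m \<longrightarrow>
       (\<exists>t s'. exec B p s t s' \<and> t \<le> T \<and> (\<forall>x<nvars. regs s' x = \<rho>' x) \<and> mem s' = m \<and>
         out s' = out s @ ys))"

lemma runs_Skip: "runs B m Skip \<rho> 1 \<rho> []"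
  unfolding runs_def using exec.Skip by (metis append_Nil2 order_refl)

lemma runs_Seq:
  assumes "runs B m p \<rho> T \<rho>' ys" "runs B m q \<rho>' T' \<rho>'' zs"
  shows "runs B m (Seq p q) \<rho> (T + T') \<rho>'' (ys @ zs)"
  unfolding runs_def
proof (intro allI impI)
  fix s :: state assume s: "(\<forall>x<nvars. regs s x = \<rho> x) \<and> mem s = m"
  obtain t1 s1 where 1: "exec B p s t1 s1" "t1 \<le> T" "\<forall>x<nvars. regs s1 x = \<rho>' x"
    "mem s1 = m" "out s1 = out s @ ys"
    using assms(1) s unfolding runs_def by blast
  obtain t2 s2 where 2: "exec B q s1 t2 s2" "t2 \<le> T'" "\<forall>x<nvars. regs s2 x = \<rho>'' x"
    "mem s2 = m" "out s2 = out s1 @ zs"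
    using assms(2) 1(3,4) unfolding runs_def by blast
  show "\<exists>t s'. exec B (Seq p q) s t s' \<and> t \<le> T + T' \<and> (\<forall>x<nvars. regs s' x = \<rho>'' x) \<and>
    mem s' = m \<and> out s' = out s @ ys @ zs"
    using 1 2 by (intro exI[of _ "t1 + t2"] exI[of _ s2]) (auto intro: exec.Seq)
qed

lemma runs_compile:
  assumes "safe B m \<rho> e" "vars_below nvars e" "\<forall>x<nvars. regs s x = \<rho> x" "mem s = m"
  obtains t \<rho>' where "exec B (compile e nvars) s t (s\<lparr>regs := \<rho>'\<rparr>)" "t \<le> time e"
    "\<rho>' nvars = val m \<rho> e" "\<forall>x<nvars. \<rho>' x = \<rho> x"
  using exec_compile[of B s e nvars] assms val_cong[of nvars e "regs s" \<rho> m]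
    safe_cong[of nvars e "regs s" \<rho> B m]
  by auto

lemma runs_assign:
  assumes "safe B m \<rho> e" "vars_below nvars e" "x < nvars"
  shows "runs B m (assign x e) \<rho> (time e + 2) (\<rho>(x := val m \<rho> e)) []"
  unfolding runs_def
proof (intro allI impI)
  fix s :: state assume s: "(\<forall>x<nvars. regs s x = \<rho> x) \<and> mem s = m"
  obtain t \<rho>' where 1: "exec B (compile e nvars) s t (s\<lparr>regs := \<rho>'\<rparr>)" "t \<le> time e"
    "\<rho>' nvars = val m \<rho> e" "\<forall>x<nvars. \<rho>' x = \<rho> x"
    using runs_compile[of B m \<rho> e s] assms s by blast
  have v: "val m \<rho> e < B"
    using assms(1) by (rule safe_val)
  let ?s = "s\<lparr>regs := \<rho>'(x := 0)\<rparr>"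
  have "exec B (SetConst x 0) (s\<lparr>regs := \<rho>'\<rparr>) 1 ?s"
    using exec.SetConst[of 0 B x "s\<lparr>regs := \<rho>'\<rparr>"] v by simp
  moreover have "exec B (Arith Plus x x nvars) ?s 1
    (?s\<lparr>regs := (regs ?s)(x := val m \<rho> e)\<rparr>)"
    using v 1(3) assms(3) by (intro exec.Arith) auto
  ultimately have "exec B (Seq (SetConst x 0) (Arith Plus x x nvars)) (s\<lparr>regs := \<rho>'\<rparr>) (1 + 1)
    (s\<lparr>regs := \<rho>'(x := val m \<rho> e)\<rparr>)"
    by (auto dest: exec.Seq)
  from exec.Seq[OF 1(1) this]
  have "exec B (assign x e) s (t + (1 + 1)) (s\<lparr>regs := \<rho>'(x := val m \<rho> e)\<rparr>)"
    by (simp add: assign_def)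
  then show "\<exists>t s'. exec B (assign x e) s t s' \<and> t \<le> time e + 2 \<and>
    (\<forall>y<nvars. regs s' y = (\<rho>(x := val m \<rho> e)) y) \<and> mem s' = m \<and> out s' = out s @ []"
    using 1 s by (intro exI[of _ "t + (1 + 1)"] exI[of _ "s\<lparr>regs := \<rho>'(x := val m \<rho> e)\<rparr>"])
       (simp del: fun_upd_apply, simp)
qed

lemma runs_writes:
  assumes "\<And>e. e \<in> set es \<Longrightarrow> safe B m \<rho> e \<and> vars_below nvars e"
  shows "runs B m (writes es) \<rho> (Suc (\<Sum>e\<leftarrow>es. Suc (time e))) \<rho> (map (val m \<rho>) es)"
  using assms
proof (induction es)
  case Nil
  then show ?case
    using runs_Skip by simp
next
  case (Cons e es)
  have "runs B m (Seq (compile e nvars) (Write nvars)) \<rho> (Suc (time e)) \<rho> [val m \<rho> e]"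
    unfolding runs_def
  proof (intro allI impI)
    fix s :: state assume s: "(\<forall>x<nvars. regs s x = \<rho> x) \<and> mem s = m"
    obtain t \<rho>' where 1: "exec B (compile e nvars) s t (s\<lparr>regs := \<rho>'\<rparr>)" "t \<le> time e"
      "\<rho>' nvars = val m \<rho> e" "\<forall>x<nvars. \<rho>' x = \<rho> x"
      using runs_compile[of B m \<rho> e s] Cons.prems s by auto
    have "exec B (Write nvars) (s\<lparr>regs := \<rho>'\<rparr>) 1 (s\<lparr>regs := \<rho>', out := out s @ [val m \<rho> e]\<rparr>)"
      using exec.Write[of B nvars "s\<lparr>regs := \<rho>'\<rparr>"] 1(3) by simp
    from exec.Seq[OF 1(1) this]
    show "\<exists>t s'. exec B (Seq (compile e nvars) (Write nvars)) s t s' \<and> t \<le> Suc (time e) \<and>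
      (\<forall>x<nvars. regs s' x = \<rho> x) \<and> mem s' = m \<and> out s' = out s @ [val m \<rho> e]"
      using 1 s by (intro exI[of _ "t + 1"]
          exI[of _ "s\<lparr>regs := \<rho>', out := out s @ [val m \<rho> e]\<rparr>"]) simp
  qed
  from runs_Seq[OF this Cons.IH] Cons.prems show ?case
    by (simp add: add_ac)
qed

text \<open>Each round costs 7 steps besides the body: 6 for the increment and 1 for the test. The
  final 1 is the failing test. The induction is on the number of remaining rounds.\<close>

lemma runs_while:
  assumes "\<And>i. i < \<rho> h \<Longrightarrow> runs B m p (\<rho>(x := i)) T (\<rho>(x := i)) (f i)"
    and "x < nvars" "h < nvars" "x \<noteq> h" "1 < B" "\<rho> h < B" "i \<le> \<rho> h"
  shows "runs B m (WhileLess x h (Seq p (assign x (Bin Plus (Var x) (Cst 1)))))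
    (\<rho>(x := i)) ((\<rho> h - i) * (T + 7) + 1) (\<rho>(x := \<rho> h)) (concat (map f [i..<\<rho> h]))"
  using assms(7)
proof (induction "\<rho> h - i" arbitrary: i)
  case 0
  then have "i = \<rho> h"
    by simp
  show ?case
    unfolding runs_def
  proof (intro allI impI)
    fix s :: state assume s: "(\<forall>y<nvars. regs s y = (\<rho>(x := i)) y) \<and> mem s = m"
    have "\<not> regs s x < regs s h"
      using s \<open>i = \<rho> h\<close> assms(2-4) by simp
    then have "exec B (WhileLess x h (Seq p (assign x (Bin Plus (Var x) (Cst 1))))) s 1 s"
      by (rule exec.WhileFalse)
    then show "\<exists>t s'. exec B (WhileLess x h (Seq p (assign x (Bin Plus (Var x) (Cst 1))))) s t s' \<and>
      t \<le> (\<rho> h - i) * (T + 7) + 1 \<and> (\<forall>y<nvars. regs s' y = (\<rho>(x := \<rho> h)) y) \<and>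
      mem s' = m \<and> out s' = out s @ concat (map f [i..<\<rho> h])"
      using s \<open>i = \<rho> h\<close> by (intro exI[of _ 1] exI[of _ s]) simp
  qed
next
  case (Suc d)
  let ?q = "Seq p (assign x (Bin Plus (Var x) (Cst 1)))"
  have i: "i < \<rho> h"
    using Suc.hyps(2) by simp
  have "runs B m (assign x (Bin Plus (Var x) (Cst 1))) (\<rho>(x := i)) 6 (\<rho>(x := Suc i)) []"
    using runs_assign[of B m "\<rho>(x := i)" "Bin Plus (Var x) (Cst 1)" x] assms i by simp
  from runs_Seq[OF assms(1)[OF i] this]
  have 1: "runs B m ?q (\<rho>(x := i)) (T + 6) (\<rho>(x := Suc i)) (f i)"
    by simp
  have 2: "runs B m (WhileLess x h ?q) (\<rho>(x := Suc i)) ((\<rho> h - Suc i) * (T + 7) + 1)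
    (\<rho>(x := \<rho> h)) (concat (map f [Suc i..<\<rho> h]))"
    using Suc i by simp
  show ?case
    unfolding runs_def
  proof (intro allI impI)
    fix s :: state assume s: "(\<forall>y<nvars. regs s y = (\<rho>(x := i)) y) \<and> mem s = m"
    obtain t1 s1 where s1: "exec B ?q s t1 s1" "t1 \<le> T + 6"
      "\<forall>y<nvars. regs s1 y = (\<rho>(x := Suc i)) y" "mem s1 = m" "out s1 = out s @ f i"
      using 1 s unfolding runs_def by blast
    obtain t2 s2 where s2: "exec B (WhileLess x h ?q) s1 t2 s2"
      "t2 \<le> (\<rho> h - Suc i) * (T + 7) + 1"
      "\<forall>y<nvars. regs s2 y = (\<rho>(x := \<rho> h)) y" "mem s2 = m"
      "out s2 = out s1 @ concat (map f [Suc i..<\<rho> h])"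
      using 2 s1(3,4) unfolding runs_def by blast
    have "regs s x < regs s h"
      using s i assms(2-4) by simp
    then have "exec B (WhileLess x h ?q) s (Suc (t1 + t2)) s2"
      using s1(1) s2(1) by (rule exec.WhileTrue)
    moreover have "Suc (t1 + t2) \<le> (\<rho> h - i) * (T + 7) + 1"
    proof -
      have "\<rho> h - i = Suc (\<rho> h - Suc i)"
        using i by simp
      then show ?thesis
        using s1(2) s2(2) by simp
    qed
    moreover have "out s2 = out s @ concat (map f [i..<\<rho> h])"
      using s1(5) s2(5) i by (simp add: upt_conv_Cons)
    ultimately show "\<exists>t s'. exec B (WhileLess x h ?q) s t s' \<and> t \<le> (\<rho> h - i) * (T + 7) + 1 \<and>
      (\<forall>y<nvars. regs s' y = (\<rho>(x := \<rho> h)) y) \<and> mem s' = m \<and>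
      out s' = out s @ concat (map f [i..<\<rho> h])"
      using s2(3,4) by blast
  qed
qed

lemma runs_for:
  assumes "\<And>i. i < \<rho> h \<Longrightarrow> runs B m p (\<rho>(x := i)) T (\<rho>(x := i)) (f i)"
    and "x < nvars" "h < nvars" "x \<noteq> h" "1 < B" "\<rho> h < B" "\<rho> x = 0"
  shows "runs B m (for_loop x h p) \<rho> (\<rho> h * (T + 7) + 4) \<rho> (concat (map f [0..<\<rho> h]))"
proof -
  have eq: "\<rho>(x := 0) = \<rho>"
    using assms(7) by auto
  have "runs B m (assign x (Cst 0)) (\<rho>(x := \<rho> h)) 3 (\<rho>(x := 0)) []"
    using runs_assign[of B m "\<rho>(x := \<rho> h)" "Cst 0" x] assms(2,5) by (simp add: numeral_3_eq_3)
  from runs_Seq[OF runs_while[OF assms(1-6), of 0] this] show ?thesis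
    by (simp add: for_loop_def eq add_ac)
qed

lemma runs_mono:
  assumes "runs B m p \<rho> T \<rho>' ys" "T \<le> T'"
  shows "runs B m p \<rho> T' \<rho>' ys"
  unfolding runs_def
proof (intro allI impI)
  fix s :: state assume "(\<forall>x<nvars. regs s x = \<rho> x) \<and> mem s = m"
  then obtain t s' where "exec B p s t s'" "t \<le> T" "\<forall>x<nvars. regs s' x = \<rho>' x" "mem s' = m"
    "out s' = out s @ ys"
    using assms(1) unfolding runs_def by blast
  then show "\<exists>t s'. exec B p s t s' \<and> t \<le> T' \<and> (\<forall>x<nvars. regs s' x = \<rho>' x) \<and>
    mem s' = m \<and> out s' = out s @ ys"
    using assms(2) by (intro exI[of _ t] exI[of _ s']) simp
qed

lemma runs_writesI:
  assumes "list_all (\<lambda>e. safe B m \<rho> e \<and> vars_below nvars e) es"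
    and "Suc (\<Sum>e\<leftarrow>es. Suc (time e)) \<le> T" "map (val m \<rho>) es = ys"
  shows "runs B m (writes es) \<rho> T \<rho> ys"
  using runs_mono[OF runs_writes assms(2)] assms(1,3) by (auto simp: list_all_iff)

lemma runs_assignI:
  assumes "safe B m \<rho> e" "vars_below nvars e" "x < nvars" "time e + 2 \<le> T"
    "\<rho>' = \<rho>(x := val m \<rho> e)"
  shows "runs B m (assign x e) \<rho> T \<rho>' []"
  using runs_mono[OF runs_assign[OF assms(1-3)] assms(4)] assms(5) by simp

section \<open>The two programs\<close>

primrec pow_expr :: "expr \<Rightarrow> nat \<Rightarrow> expr" where
  "pow_expr e 0 = Cst 1"
| "pow_expr e (Suc k) = Bin Times e (pow_expr e k)"

lemma val_pow_expr [simp]: "val m \<rho> (pow_expr e k) = val m \<rho> e ^ k"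
  by (induction k) auto

lemma vars_below_pow_expr [simp]: "vars_below r e \<Longrightarrow> vars_below r (pow_expr e k)"
  by (induction k) auto

lemma time_pow_expr [simp]: "time (pow_expr e k) = k * (time e + 1) + 1"
  by (induction k) auto

text \<open>With a base of at least 1 the powers do not decrease, so a bound on the last one covers
  all intermediate products.\<close>

lemma safe_pow_expr:
  assumes "safe B m \<rho> e" "1 \<le> val m \<rho> e" "val m \<rho> e ^ k < B"
  shows "safe B m \<rho> (pow_expr e k)"
  using assms(3)
proof (induction k)
  case (Suc k)
  have "val m \<rho> e ^ k \<le> val m \<rho> e ^ Suc k"
    using assms(2) by (intro power_increasing) auto
  then have "val m \<rho> e ^ k < B"
    using Suc.prems by linarith
  then show ?case
    using Suc assms(1) by simp
qed simp

definition label_expr :: "nat \<Rightarrow> expr \<Rightarrow> expr" where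
  "label_expr c e = Bin Plus (Bin Times (Cst 7) e) (Cst c)"

lemma label_expr_simps [simp]:
  "val m \<rho> (label_expr c e) = lab c (val m \<rho> e)"
  "vars_below r (label_expr c e) \<longleftrightarrow> vars_below r e"
  "time (label_expr c e) = time e + 4"
  by (auto simp: label_expr_def lab_def)

lemma safe_label_expr:
  "safe B m \<rho> e \<Longrightarrow> lab c (val m \<rho> e) < B \<Longrightarrow> 7 < B \<Longrightarrow> safe B m \<rho> (label_expr c e)"
  by (auto simp: label_expr_def lab_def)

text \<open>Follows \<open>encode_spine\<close>: one loop down the spine, the bottom node, one loop
  back up. Register \<open>h\<close> holds the spine length.\<close>

definition write_comb :: "nat \<Rightarrow> reg \<Rightarrow> com" where
  "write_comb c h =
     Seq (for_loop 1 h (writes [label_expr c (Var 1), Cst 3, label_expr (c + 1) (Var 1), Cst 0]))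
     (Seq (writes [label_expr c (Var h), Cst 0])
       (for_loop 1 h (writes
         [label_expr (c + 2) (Bin Minus (Bin Minus (Var h) (Cst 1)) (Var 1)), Cst 0])))"

lemma runs_write_comb:
  fixes \<rho> :: "nat \<Rightarrow> nat"
  assumes "h < nvars" "h \<noteq> 1" "\<rho> 1 = 0" "lab (c + 2) (\<rho> h) < B" "7 < B"
  shows "runs B m (write_comb c h) \<rho> (\<rho> h * 48 + 18) \<rho> (encode_tree (comb c (\<rho> h)))"
proof -
  have B: "7 * \<rho> h + c + 2 < B"
    using assms(4) by (simp add: lab_def)
  have 1: "runs B m (for_loop 1 h (writes [label_expr c (Var 1), Cst 3, label_expr (c + 1) (Var 1),
      Cst 0])) \<rho> (\<rho> h * (19 + 7) + 4) \<rho>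
      (concat (map (\<lambda>t. [lab c t, 3, lab (c + 1) t, 0]) [0..<\<rho> h]))"
  proof (rule runs_for)
    fix i assume i: "i < \<rho> h"
    show "runs B m (writes [label_expr c (Var 1), Cst 3, label_expr (c + 1) (Var 1), Cst 0])
      (\<rho>(1 := i)) 19 (\<rho>(1 := i)) [lab c i, 3, lab (c + 1) i, 0]"
      by (rule runs_writesI) (use i B assms(5) in \<open>auto intro!: safe_label_expr simp: lab_def\<close>)
  qed (use assms B in auto)
  have 2: "runs B m (writes [label_expr c (Var h), Cst 0]) \<rho> 10 \<rho> [lab c (\<rho> h), 0]"
    by (rule runs_writesI) (use B assms(1,5) in \<open>auto intro!: safe_label_expr simp: lab_def\<close>)
  have 3: "runs B m (for_loop 1 h (writes
      [label_expr (c + 2) (Bin Minus (Bin Minus (Var h) (Cst 1)) (Var 1)), Cst 0])) \<rho>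
      (\<rho> h * (15 + 7) + 4) \<rho> (concat (map (\<lambda>t. [lab (c + 2) (\<rho> h - 1 - t), 0]) [0..<\<rho> h]))"
  proof (rule runs_for)
    fix i assume i: "i < \<rho> h"
    show "runs B m (writes [label_expr (c + 2) (Bin Minus (Bin Minus (Var h) (Cst 1)) (Var 1)),
        Cst 0]) (\<rho>(1 := i)) 15 (\<rho>(1 := i)) [lab (c + 2) (\<rho> h - 1 - i), 0]"
      by (rule runs_writesI) (use i B assms(1,2,5) in \<open>auto intro!: safe_label_expr simp: lab_def\<close>)
  qed (use assms B in auto)
  show ?thesis
    using runs_Seq[OF 1 runs_Seq[OF 2 3]]
    by (simp add: write_comb_def comb_def encode_spine algebra_simps del: writes.simps)
qed

section \<open>Decoding labels and guarding expressions by tests\<close>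

definition quot :: "reg \<Rightarrow> expr" where
  "quot x = Bin Divide (Var x) (Cst 7)"

definition rem :: "reg \<Rightarrow> expr" where
  "rem x = Bin Minus (Var x) (Bin Times (Cst 7) (quot x))"

lemma quot_rem_simps [simp]:
  "val m \<rho> (quot x) = \<rho> x div 7" "val m \<rho> (rem x) = \<rho> x mod 7"
  "vars_below r (quot x) \<longleftrightarrow> x < r" "vars_below r (rem x) \<longleftrightarrow> x < r"
  by (auto simp: quot_def rem_def minus_mult_div_eq_mod)

lemma safe_quot_rem:
  assumes "\<rho> x < B" "7 < B"
  shows "safe B m \<rho> (quot x)" "safe B m \<rho> (rem x)"
proof -
  have "\<rho> x div 7 \<le> \<rho> x" "7 * (\<rho> x div 7) \<le> \<rho> x"
    by simp_all
  then show "safe B m \<rho> (quot x)" "safe B m \<rho> (rem x)"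
    using assms unfolding quot_def rem_def by (auto simp: minus_mult_div_eq_mod)
qed

definition guard :: "(expr \<times> expr) list \<Rightarrow> expr \<Rightarrow> expr" where
  "guard gs e = foldr (\<lambda>(a, b) x. Cond a b x (Cst 0)) gs e"

lemma val_guard: "val m \<rho> (guard gs e) =
    (if \<forall>(a, b) \<in> set gs. val m \<rho> a < val m \<rho> b then val m \<rho> e else 0)"
  by (induction gs) (auto simp: guard_def)

lemma safe_guard:
  assumes "\<forall>(a, b) \<in> set gs. safe B m \<rho> a \<and> safe B m \<rho> b" "0 < B"
    and "\<forall>(a, b) \<in> set gs. val m \<rho> a < val m \<rho> b \<Longrightarrow> safe B m \<rho> e"
  shows "safe B m \<rho> (guard gs e)"
  using assms by (induction gs) (auto simp: guard_def)

lemma vars_below_guard: "vars_below r (guard gs e) \<longleftrightarrow>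
    (\<forall>(a, b) \<in> set gs. vars_below r a \<and> vars_below r b) \<and> vars_below r e"
  by (induction gs) (auto simp: guard_def)

text \<open>The only test of the machine is a strict comparison, so each of the two equations
  becomes a pair of strict inequalities.\<close>

definition class_test :: "nat \<Rightarrow> nat \<Rightarrow> (expr \<times> expr) list" where
  "class_test c d = [(Cst c, Bin Plus (rem 1) (Cst 1)), (rem 1, Cst (c + 1)),
     (Cst d, Bin Plus (rem 2) (Cst 1)), (rem 2, Cst (d + 1))]"

lemma class_test_val:
  "(\<forall>(a, b) \<in> set (class_test c d). val m \<rho> a < val m \<rho> b) \<longleftrightarrow> \<rho> 1 mod 7 = c \<and> \<rho> 2 mod 7 = d"
  by (auto simp: class_test_def)

lemma class_test_safe:
  assumes "c < 7" "d < 7" "\<rho> 1 < B" "\<rho> 2 < B" "7 < B"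
  shows "\<forall>(a, b) \<in> set (class_test c d). safe B m \<rho> a \<and> safe B m \<rho> b"
proof -
  have "\<rho> 1 mod 7 < 7" "\<rho> 2 mod 7 < 7"
    by simp_all
  then have "\<rho> 1 mod 7 + 1 < B" "\<rho> 2 mod 7 + 1 < B"
    using assms(5) by linarith+
  then show ?thesis
    using assms safe_quot_rem by (auto simp: class_test_def)
qed

text \<open>Registers: 0 holds \<open>n\<close>, 3 to 5 hold \<open>U\<close>, \<open>L\<close> and \<open>H\<close>, 6 the alphabet size and 7 the
  length \<open>2 * n\<close> of the first tree's spine; 1 and 2 are loop counters.\<close>

definition penalized_expr :: "expr \<Rightarrow> expr \<Rightarrow> expr" where
  "penalized_expr x y = (let e = Mem (Bin Plus (Cst 1) (Bin Plus (Bin Times x (Var 0)) y)) in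
     Cond x y e (Cond y x e (Var 3)))"

definition root_expr :: expr where
  "root_expr = guard (class_test 0 6 @ [(quot 1, Var 0)])
     (Bin Times (Bin Times (Cst 2) (Var 4)) (quot 1))"

definition ij_expr :: expr where
  "ij_expr = (let x = Bin Minus (quot 1) (Var 0) in
     guard (class_test 0 2 @
       [(Var 0, Bin Plus (quot 1) (Cst 1)), (quot 1, Var 7), (quot 2, Var 0)])
     (Bin Minus (Bin Plus (Var 5) (Bin Times (Var 4) (quot 2)))
       (Bin Plus (Bin Times (Var 4) x) (penalized_expr x (quot 2)))))"

definition jk_expr :: expr where
  "jk_expr = (let y = Bin Minus (quot 2) (Cst 1) in
     guard (class_test 1 0 @
       [(quot 1, Var 0), (Cst 0, quot 2), (quot 2, Bin Plus (Var 0) (Cst 1))])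
     (Bin Minus (Var 5) (Bin Plus (Bin Plus (Bin Times (Var 4) (quot 1)) (Bin Times (Var 4) y))
       (penalized_expr y (quot 1)))))"

definition ik_expr :: expr where
  "ik_expr = guard (class_test 2 3 @ [(quot 1, Var 0), (quot 2, Var 0)])
     (Bin Minus (Var 5) (Bin Plus (Bin Plus (Bin Times (Var 4) (quot 1))
       (Bin Times (Var 4) (quot 2))) (penalized_expr (quot 2) (quot 1))))"

definition link_expr :: expr where
  "link_expr = guard (class_test 2 4 @ [(Var 0, Bin Plus (quot 1) (Cst 1))])
     (Bin Times (Cst 2) (Var 4))"

definition match_expr :: expr where
  "match_expr = Bin Minus (Bin Times (Cst 2) (Var 5))
     (Bin Plus (Bin Plus (Bin Plus (Bin Plus root_expr ij_expr) jk_expr) ik_expr) link_expr)"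

lemmas gain_expr_defs = root_expr_def ij_expr_def jk_expr_def ik_expr_def link_expr_def

lemma vars_below_match_expr: "vars_below nvars match_expr"
  by (simp add: match_expr_def gain_expr_defs vars_below_guard Let_def class_test_def
      penalized_expr_def)

section \<open>Word bounds and evaluation of the matching costs\<close>

context weights
begin

lemma H_bounds: "14 * n + 7 \<le> H" "L * n \<le> H" "U \<le> H" "n * n \<le> H" "L \<le> H" "8 \<le> H"
proof -
  have "n ^ 4 * 1 \<le> H"
    using U_pos by (intro mult_left_mono) auto
  moreover have "27 * n \<le> n ^ 4"
  proof -
    have "3 ^ 3 * n \<le> n ^ 3 * n"
      using three_le_n by (intro mult_right_mono power_mono) auto
    then show ?thesis
      by (simp add: power_numeral_reduce)
  qed
  moreover have "n * n \<le> n ^ 4"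
    using three_le_n power_increasing[of 2 4 n] by (simp add: power2_eq_square)
  ultimately show "14 * n + 7 \<le> H" "n * n \<le> H" "8 \<le> H"
    using three_le_n by linarith+
  show "L * n \<le> H" "U \<le> H"
    using H_large by linarith+
  have "L * 1 \<le> L * n"
    using three_le_n by (intro mult_left_mono) auto
  then show "L \<le> H"
    using H_large by linarith
qed

lemma W_le_U: "i < n \<Longrightarrow> j < n \<Longrightarrow> W i j \<le> U"
  using triple_le_U[of i j] by (auto simp: penalized_def)

lemma L_mult_le: "x < n \<Longrightarrow> L * x \<le> L * n"
  by simp

context
  fixes B :: nat and m \<rho> :: "nat \<Rightarrow> nat"
  assumes B: "8 * H \<le> B"
    and m: "\<And>i j. i < n \<Longrightarrow> j < n \<Longrightarrow> i \<noteq> j \<Longrightarrow> m (1 + (i * n + j)) = w i j"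
    and \<rho>: "\<rho> 0 = n" "\<rho> 3 = U" "\<rho> 4 = L" "\<rho> 5 = H" "\<rho> 7 = 2 * n"
    and counters: "\<rho> 1 < 14 * n + 7" "\<rho> 2 < 14 * n + 7"
begin

lemma counter_bounds: "\<rho> 1 < B" "\<rho> 2 < B" "7 < B" "\<rho> 1 div 7 \<le> 2 * n" "\<rho> 2 div 7 \<le> 2 * n"
  using counters H_bounds(1) B by linarith+

text \<open>The weights are stored row by row after \<open>n\<close>, hence from address 1 on. For
  equal indices both comparisons fail and the value is taken from register 3, without reading the
  table.\<close>

lemma penalized_expr:
  assumes "safe B m \<rho> x" "safe B m \<rho> y" "val m \<rho> x < n" "val m \<rho> y < n"
  shows "val m \<rho> (penalized_expr x y) = W (val m \<rho> x) (val m \<rho> y)"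
    and "safe B m \<rho> (penalized_expr x y)"
proof -
  let ?x = "val m \<rho> x" and ?y = "val m \<rho> y"
  have "?x * n + ?y < n * n"
  proof -
    have "?x * n + ?y < Suc ?x * n"
      using assms(4) by simp
    also have "\<dots> \<le> n * n"
      using assms(3) by (intro mult_right_mono) auto
    finally show ?thesis .
  qed
  then have i: "1 + (?x * n + ?y) < B" "?x * n + ?y < B" "?x * n < B"
    using H_bounds(4,6) B by linarith+
  have w: "w ?x ?y < B" if "?x \<noteq> ?y"
    using triple_le_U[OF assms(3,4) that] H_bounds(3,6) B by linarith
  have U: "U < B" "n < B" "1 < B"
    using H_bounds B by linarith+
  have m': "?x \<noteq> ?y \<Longrightarrow> m (Suc (?x * n + ?y)) = w ?x ?y"
    using m[OF assms(3,4)] by simp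
  show "val m \<rho> (penalized_expr x y) = W ?x ?y"
    using m' by (auto simp: penalized_expr_def Let_def \<rho> penalized_def)
  show "safe B m \<rho> (penalized_expr x y)"
    using assms i w U m' by (auto simp: penalized_expr_def Let_def \<rho>)
qed

lemma safe_quot: "safe B m \<rho> (quot 1)" "safe B m \<rho> (quot 2)"
  using safe_quot_rem counter_bounds by blast+

lemma register_bounds: "n < B" "U < B" "L < B" "H < B" "2 * n < B" "2 * H < B" "2 * L < B"
    "\<rho> 1 div 7 + 1 < B" "\<rho> 2 div 7 + 1 < B"
  using H_bounds B counter_bounds by linarith+

lemma test_iff:
  "(\<forall>(a, b) \<in> set (class_test c d @ gs). val m \<rho> a < val m \<rho> b) \<longleftrightarrow>
     \<rho> 1 mod 7 = c \<and> \<rho> 2 mod 7 = d \<and> (\<forall>(a, b) \<in> set gs. val m \<rho> a < val m \<rho> b)"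
  using class_test_val[of c d m \<rho>] by (simp add: ball_Un)

lemma test_safe:
  assumes "c < 7" "d < 7" "\<forall>(a, b) \<in> set gs. safe B m \<rho> a \<and> safe B m \<rho> b"
  shows "\<forall>(a, b) \<in> set (class_test c d @ gs). safe B m \<rho> a \<and> safe B m \<rho> b"
  using class_test_safe[OF assms(1,2) counter_bounds(1-3)] assms(3) by (auto simp: ball_Un)

text \<open>The arithmetic has to be safe only if the tests succeed, and then they bound the indices
  by \<open>n\<close>, which keeps products with \<open>L\<close> below \<open>H\<close>. The next
  four lemmas follow the same pattern.\<close>

lemma root_expr:
  "val m \<rho> root_expr = gain_root n L (\<rho> 1) (\<rho> 2)" "safe B m \<rho> root_expr"
proof -
  show "val m \<rho> root_expr = gain_root n L (\<rho> 1) (\<rho> 2)"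
    unfolding root_expr_def val_guard test_iff by (simp add: \<rho> gain_root_def)
  show "safe B m \<rho> root_expr"
    unfolding root_expr_def
  proof (rule safe_guard[OF test_safe])
    assume "\<forall>(a, b) \<in> set (class_test 0 6 @ [(quot 1, Var 0)]). val m \<rho> a < val m \<rho> b"
    then have "\<rho> 1 div 7 < n"
      unfolding test_iff by (simp add: \<rho>)
    then have "2 * (L * (\<rho> 1 div 7)) < B"
      using L_mult_le[of "\<rho> 1 div 7"] H_bounds(2,6) B by linarith
    then show "safe B m \<rho> (Bin Times (Bin Times (Cst 2) (Var 4)) (quot 1))"
      using safe_quot register_bounds counter_bounds by (simp add: \<rho> mult.assoc)
  qed (use safe_quot register_bounds in \<open>auto simp: \<rho>\<close>)
qed

lemma ij_expr:
  "val m \<rho> ij_expr = gain_ij n L H W (\<rho> 1) (\<rho> 2)" "safe B m \<rho> ij_expr"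
proof -
  let ?x = "Bin Minus (quot 1) (Var 0)"
  have x: "safe B m \<rho> ?x"
    using safe_quot register_bounds by (simp add: \<rho>)
  show "val m \<rho> ij_expr = gain_ij n L H W (\<rho> 1) (\<rho> 2)"
    unfolding ij_expr_def Let_def val_guard test_iff gain_ij_def
    using penalized_expr(1)[OF x safe_quot(2)] by (auto simp: \<rho> less_Suc_eq_le)
  show "safe B m \<rho> ij_expr"
    unfolding ij_expr_def Let_def
  proof (rule safe_guard[OF test_safe])
    assume "\<forall>(a, b) \<in> set (class_test 0 2 @
      [(Var 0, Bin Plus (quot 1) (Cst 1)), (quot 1, Var 7), (quot 2, Var 0)]).
      val m \<rho> a < val m \<rho> b"
    then have i: "\<rho> 1 div 7 - n < n" "\<rho> 2 div 7 < n"
      unfolding test_iff by (auto simp: \<rho>)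
    have "L * (\<rho> 1 div 7 - n) + W (\<rho> 1 div 7 - n) (\<rho> 2 div 7) < B" "L * (\<rho> 1 div 7 - n) < B"
      "L * (\<rho> 2 div 7) < B" "H + L * (\<rho> 2 div 7) < B"
      using L_mult_le[OF i(1)] L_mult_le[OF i(2)] W_le_U[OF i] H_bounds(2,3,6) B by linarith+
    moreover from this have "H + L * (\<rho> 2 div 7) - z < B" for z
      by linarith
    ultimately show "safe B m \<rho> (Bin Minus (Bin Plus (Var 5) (Bin Times (Var 4) (quot 2)))
       (Bin Plus (Bin Times (Var 4) ?x) (penalized_expr ?x (quot 2))))"
      using safe_quot register_bounds x penalized_expr[OF x safe_quot(2)] i by (simp add: \<rho>)
  qed (use safe_quot register_bounds counter_bounds in \<open>auto simp: \<rho>\<close>)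
qed

lemma jk_expr:
  "val m \<rho> jk_expr = gain_jk n L H W (\<rho> 1) (\<rho> 2)" "safe B m \<rho> jk_expr"
proof -
  let ?y = "Bin Minus (quot 2) (Cst 1)"
  have y: "safe B m \<rho> ?y"
    using safe_quot register_bounds counter_bounds by simp
  show "val m \<rho> jk_expr = gain_jk n L H W (\<rho> 1) (\<rho> 2)"
    unfolding jk_expr_def Let_def val_guard test_iff gain_jk_def
    using penalized_expr(1)[OF y safe_quot(1)] by (auto simp: \<rho> less_Suc_eq_le)
  show "safe B m \<rho> jk_expr"
    unfolding jk_expr_def Let_def
  proof (rule safe_guard[OF test_safe])
    assume "\<forall>(a, b) \<in> set (class_test 1 0 @
       [(quot 1, Var 0), (Cst 0, quot 2), (quot 2, Bin Plus (Var 0) (Cst 1))]).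
      val m \<rho> a < val m \<rho> b"
    then have i: "\<rho> 2 div 7 - 1 < n" "\<rho> 1 div 7 < n"
      unfolding test_iff by (auto simp: \<rho>)
    have "L * (\<rho> 1 div 7) + L * (\<rho> 2 div 7 - 1) + W (\<rho> 2 div 7 - 1) (\<rho> 1 div 7) < B"
      "L * (\<rho> 1 div 7) + L * (\<rho> 2 div 7 - 1) < B"
      "L * (\<rho> 2 div 7 - 1) < B" "L * (\<rho> 1 div 7) < B"
      using L_mult_le[OF i(1)] L_mult_le[OF i(2)] W_le_U[OF i] H_bounds(2,3,6) B by linarith+
    moreover have "H - z < B" for z
      using register_bounds(4) by linarith
    ultimately show "safe B m \<rho> (Bin Minus (Var 5) (Bin Plus (Bin Plus (Bin Times (Var 4) (quot 1))
       (Bin Times (Var 4) ?y)) (penalized_expr ?y (quot 1))))"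
      using safe_quot register_bounds y penalized_expr[OF y safe_quot(1)] i by (simp add: \<rho>)
  qed (use safe_quot register_bounds counter_bounds H_bounds B in \<open>auto simp: \<rho>\<close>)
qed

lemma ik_expr:
  "val m \<rho> ik_expr = gain_ik n L H W (\<rho> 1) (\<rho> 2)" "safe B m \<rho> ik_expr"
proof -
  show "val m \<rho> ik_expr = gain_ik n L H W (\<rho> 1) (\<rho> 2)"
    unfolding ik_expr_def val_guard test_iff gain_ik_def
    using penalized_expr(1)[OF safe_quot(2,1)] by (auto simp: \<rho>)
  show "safe B m \<rho> ik_expr"
    unfolding ik_expr_def
  proof (rule safe_guard[OF test_safe])
    assume "\<forall>(a, b) \<in> set (class_test 2 3 @ [(quot 1, Var 0), (quot 2, Var 0)]).
      val m \<rho> a < val m \<rho> b"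
    then have i: "\<rho> 2 div 7 < n" "\<rho> 1 div 7 < n"
      unfolding test_iff by (auto simp: \<rho>)
    have "L * (\<rho> 1 div 7) + L * (\<rho> 2 div 7) + W (\<rho> 2 div 7) (\<rho> 1 div 7) < B"
      "L * (\<rho> 1 div 7) + L * (\<rho> 2 div 7) < B" "L * (\<rho> 2 div 7) < B" "L * (\<rho> 1 div 7) < B"
      using L_mult_le[OF i(1)] L_mult_le[OF i(2)] W_le_U[OF i] H_bounds(2,3,6) B by linarith+
    moreover have "H - z < B" for z
      using register_bounds(4) by linarith
    ultimately show "safe B m \<rho> (Bin Minus (Var 5) (Bin Plus (Bin Plus (Bin Times (Var 4) (quot 1))
       (Bin Times (Var 4) (quot 2))) (penalized_expr (quot 2) (quot 1))))"
      using safe_quot register_bounds penalized_expr[OF safe_quot(2,1)] i by (simp add: \<rho>)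
  qed (use safe_quot register_bounds in \<open>auto simp: \<rho>\<close>)
qed

lemma link_expr:
  "val m \<rho> link_expr = gain_link n L (\<rho> 1) (\<rho> 2)" "safe B m \<rho> link_expr"
proof -
  show "val m \<rho> link_expr = gain_link n L (\<rho> 1) (\<rho> 2)"
    unfolding link_expr_def val_guard test_iff gain_link_def by (auto simp: \<rho>)
  show "safe B m \<rho> link_expr"
    unfolding link_expr_def
    by (rule safe_guard[OF test_safe])
      (use safe_quot register_bounds counter_bounds in \<open>auto simp: \<rho>\<close>)
qed

text \<open>The sum of the five gains is at most \<open>2 * H\<close> by \<open>gain_le\<close>, so
  it and all its partial sums fit into a word.\<close>

lemma match_expr:
  "val m \<rho> match_expr = match_cost (gadget n U w) (\<rho> 1) (\<rho> 2)" "safe B m \<rho> match_expr"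
proof -
  note exprs = root_expr ij_expr jk_expr ik_expr link_expr
  show "val m \<rho> match_expr = match_cost (gadget n U w) (\<rho> 1) (\<rho> 2)"
    by (simp add: match_expr_def exprs \<rho> gadget_def gain_def)
  have "gain_root n L (\<rho> 1) (\<rho> 2) + gain_ij n L H W (\<rho> 1) (\<rho> 2) + gain_jk n L H W (\<rho> 1) (\<rho> 2) +
     gain_ik n L H W (\<rho> 1) (\<rho> 2) + gain_link n L (\<rho> 1) (\<rho> 2) < B"
    using gain_le[of "\<rho> 1" "\<rho> 2"] register_bounds(6) unfolding gain_def by linarith
  moreover have "2 * H - z < B" for z
    using register_bounds(6) by linarith
  ultimately show "safe B m \<rho> match_expr"
    using register_bounds counter_bounds by (simp add: match_expr_def exprs \<rho>)
qed

end

end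

text \<open>The alphabet size is computed as \<open>lab 7 (2 * n) = 14 * n + 7\<close>. The words 6
  and 2 are the label and the number of children of the root of the second tree.\<close>

definition construct_gadget :: "nat \<Rightarrow> com" where
  "construct_gadget K =
     Seq (assign 0 (Mem (Cst 0)))
    (Seq (assign 3 (pow_expr (Var 0) (K + 2)))
    (Seq (assign 4 (Bin Times (Var 0) (Var 3)))
    (Seq (assign 5 (Bin Times (pow_expr (Var 0) 4) (Var 3)))
    (Seq (assign 7 (Bin Times (Cst 2) (Var 0)))
    (Seq (assign 6 (label_expr 7 (Var 7)))
    (Seq (writes [Var 6])
    (Seq (write_comb 0 7)
    (Seq (writes [Cst 6, Cst 2])
    (Seq (write_comb 0 0)
    (Seq (write_comb 3 0)
    (Seq (for_loop 1 6 (writes [Var 5]))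
         (for_loop 1 6 (for_loop 2 6 (writes [match_expr]))))))))))))))"

text \<open>Subtracts \<open>H * (12 * n + 1)\<close>, the part of the edit distance that does not
  depend on the weights. For \<open>U = n ^ (K + 2)\<close> the value of \<open>H\<close> is
  \<open>n ^ (K + 6)\<close>.\<close>

definition extract_triangle :: "nat \<Rightarrow> com" where
  "extract_triangle K = writes [Bin Minus (Mem (Cst 1)) (Bin Times (pow_expr (Mem (Cst 0)) (K + 6))
     (Bin Plus (Bin Times (Cst 12) (Mem (Cst 0))) (Cst 1)))]"

definition time_factor :: "nat \<Rightarrow> nat" where
  "time_factor K = time (pow_expr (Var 0) (K + 2)) + time match_expr + 1000"

lemma runs_computes:
  assumes "runs B (mem (initial_state xs)) p (\<lambda>_. 0) T \<rho> ys" "0 < B" "set xs \<subseteq> {..<B}"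
  obtains t where "t \<le> T" "computes B p xs t ys"
proof -
  have "\<forall>x<nvars. regs (initial_state xs) x = 0"
    by (simp add: initial_state_def)
  then obtain t s where "exec B p (initial_state xs) t s" "t \<le> T" "out s = out (initial_state xs) @ ys"
    using assms(1) unfolding runs_def by blast
  then show thesis
    using that[of t] assms(2,3) by (auto simp: computes_def initial_state_def)
qed

section \<open>Layout of the encoded graph in memory\<close>

lemma nth_concat_uniform:
  assumes "\<And>x. x \<in> set xs \<Longrightarrow> length (f x) = k" "i < length xs" "j < k"
  shows "concat (map f xs) ! (i * k + j) = f (xs ! i) ! j"
  using assms(1,2)
proof (induction xs arbitrary: i)
  case (Cons x xs)
  show ?case
  proof (cases i)
    case 0
    then show ?thesis
      using Cons.prems assms(3) by (simp add: nth_append)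
  next
    case (Suc i')
    then have "concat (map f xs) ! (i' * k + j) = f (xs ! i') ! j"
      using Cons by simp
    then show ?thesis
      using Cons.prems Suc by (simp add: nth_append)
  qed
qed simp

lemma length_encode_graph: "length (encode_graph n w) = 1 + n * n"
  by (simp add: encode_graph_def length_concat comp_def sum_list_triv)

lemma encode_graph_nth:
  assumes "i < n" "j < n" "i \<noteq> j"
  shows "encode_graph n w ! (1 + (i * n + j)) = w i j"
  using nth_concat_uniform[of "[0..<n]" "\<lambda>i. map (\<lambda>j. if i = j then 0 else w i j) [0..<n]" n i j]
    assms
  by (simp add: encode_graph_def)

lemma mem_encode_graph:
  "mem (initial_state (encode_graph n w)) 0 = n"
  "i < n \<Longrightarrow> j < n \<Longrightarrow> i \<noteq> j \<Longrightarrow>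
    mem (initial_state (encode_graph n w)) (1 + (i * n + j)) = w i j"
proof -
  show "mem (initial_state (encode_graph n w)) 0 = n"
    by (simp add: initial_state_def encode_graph_def)
  assume ij: "i < n" "j < n" "i \<noteq> j"
  have "i * n + j < Suc i * n"
    using ij by simp
  also have "\<dots> \<le> n * n"
    using ij by (intro mult_right_mono) auto
  finally show "mem (initial_state (encode_graph n w)) (1 + (i * n + j)) = w i j"
    using encode_graph_nth[OF ij] by (simp add: initial_state_def length_encode_graph)
qed

context weights
begin

text \<open>Every entry of the matching cost table takes constant time, as \<open>K\<close> is
  fixed, and contributes a word to the output. All other work is at most linear in the alphabet
  size.\<close>

lemma runs_construct:
  assumes U: "U = n ^ (K + 2)" and B: "8 * H \<le> B"
    and m: "m 0 = n" "\<And>i j. i < n \<Longrightarrow> j < n \<Longrightarrow> i \<noteq> j \<Longrightarrow> m (1 + (i * n + j)) = w i j"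
  shows "\<exists>T \<rho>. runs B m (construct_gadget K) (\<lambda>_. 0) T \<rho> (encode_instance (gadget n U w)) \<and>
    T \<le> time_factor K * length (encode_instance (gadget n U w))"
proof -
  define A where "A = 14 * n + 7"
  define \<rho> where "\<rho> = (\<lambda>_ :: nat. 0 :: nat)(0 := n, 3 := U, 4 := L, 5 := H, 7 := 2 * n, 6 := A)"
  have \<rho>: "\<rho> 0 = n" "\<rho> 1 = 0" "\<rho> 2 = 0" "\<rho> 3 = U" "\<rho> 4 = L" "\<rho> 5 = H" "\<rho> 7 = 2 * n" "\<rho> 6 = A"
    by (simp_all add: \<rho>_def)
  have H: "14 * n + 7 \<le> H" "U \<le> H" "L \<le> H"
    using H_bounds by blast+
  have "n ^ 4 * 1 \<le> H"
    using U_pos by (intro mult_left_mono) auto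
  then have bd: "A < B" "U < B" "L < B" "H < B" "n < B" "2 * n < B" "7 < B" "n ^ 4 < B"
    using H B three_le_n unfolding A_def by linarith+
  have prefix: "runs B m (assign 0 (Mem (Cst 0))) (\<lambda>_. 0) 4 ((\<lambda>_. 0)(0 := n)) []"
    "runs B m (assign 3 (pow_expr (Var 0) (K + 2))) ((\<lambda>_. 0)(0 := n))
      (time (pow_expr (Var 0) (K + 2)) + 2) ((\<lambda>_. 0)(0 := n, 3 := U)) []"
    "runs B m (assign 4 (Bin Times (Var 0) (Var 3))) ((\<lambda>_. 0)(0 := n, 3 := U)) 7
      ((\<lambda>_. 0)(0 := n, 3 := U, 4 := L)) []"
    "runs B m (assign 5 (Bin Times (pow_expr (Var 0) 4) (Var 3))) ((\<lambda>_. 0)(0 := n, 3 := U, 4 := L))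
      18 ((\<lambda>_. 0)(0 := n, 3 := U, 4 := L, 5 := H)) []"
    "runs B m (assign 7 (Bin Times (Cst 2) (Var 0))) ((\<lambda>_. 0)(0 := n, 3 := U, 4 := L, 5 := H)) 6
      ((\<lambda>_. 0)(0 := n, 3 := U, 4 := L, 5 := H, 7 := 2 * n)) []"
    "runs B m (assign 6 (label_expr 7 (Var 7)))
      ((\<lambda>_. 0)(0 := n, 3 := U, 4 := L, 5 := H, 7 := 2 * n)) 8 \<rho> []"
  proof -
    show "runs B m (assign 0 (Mem (Cst 0))) (\<lambda>_. 0) 4 ((\<lambda>_. 0)(0 := n)) []"
      by (rule runs_assignI) (use m(1) bd in auto)
    show "runs B m (assign 3 (pow_expr (Var 0) (K + 2))) ((\<lambda>_. 0)(0 := n))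
      (time (pow_expr (Var 0) (K + 2)) + 2) ((\<lambda>_. 0)(0 := n, 3 := U)) []"
    proof (rule runs_assignI)
      show "safe B m ((\<lambda>_. 0)(0 := n)) (pow_expr (Var 0) (K + 2))"
        by (rule safe_pow_expr) (use bd three_le_n U in auto)
    qed (use U in auto)
    show "runs B m (assign 4 (Bin Times (Var 0) (Var 3))) ((\<lambda>_. 0)(0 := n, 3 := U)) 7
      ((\<lambda>_. 0)(0 := n, 3 := U, 4 := L)) []"
      by (rule runs_assignI) (use bd in auto)
    show "runs B m (assign 5 (Bin Times (pow_expr (Var 0) 4) (Var 3)))
      ((\<lambda>_. 0)(0 := n, 3 := U, 4 := L)) 18 ((\<lambda>_. 0)(0 := n, 3 := U, 4 := L, 5 := H)) []"
      by (rule runs_assignI) (use bd three_le_n in \<open>auto intro!: safe_pow_expr\<close>)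
    show "runs B m (assign 7 (Bin Times (Cst 2) (Var 0))) ((\<lambda>_. 0)(0 := n, 3 := U, 4 := L, 5 := H))
      6 ((\<lambda>_. 0)(0 := n, 3 := U, 4 := L, 5 := H, 7 := 2 * n)) []"
      by (rule runs_assignI) (use bd in auto)
    show "runs B m (assign 6 (label_expr 7 (Var 7)))
      ((\<lambda>_. 0)(0 := n, 3 := U, 4 := L, 5 := H, 7 := 2 * n)) 8 \<rho> []"
      by (rule runs_assignI)
        (use bd in \<open>auto intro!: safe_label_expr simp: \<rho>_def A_def lab_def\<close>)
  qed
  have alphabet: "runs B m (writes [Var 6]) \<rho> 4 \<rho> [A]"
    by (rule runs_writesI) (use bd \<rho> in auto)
  have combs: "runs B m (write_comb 0 7) \<rho> (2 * n * 48 + 18) \<rho> (encode_tree (tree_F n))"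
    "runs B m (write_comb 0 0) \<rho> (n * 48 + 18) \<rho> (encode_tree (comb 0 n))"
    "runs B m (write_comb 3 0) \<rho> (n * 48 + 18) \<rho> (encode_tree (comb 3 n))"
    using runs_write_comb[of 7 \<rho> 0 B m] runs_write_comb[of 0 \<rho> 0 B m]
      runs_write_comb[of 0 \<rho> 3 B m] bd
    by (simp_all add: \<rho> \<rho>(2)[unfolded One_nat_def] A_def lab_def tree_F_def)
  have root: "runs B m (writes [Cst 6, Cst 2]) \<rho> 5 \<rho> [6, 2]"
    by (rule runs_writesI) (use bd in auto)
  have del: "runs B m (for_loop 1 6 (writes [Var 5])) \<rho> (A * (4 + 7) + 4) \<rho>
    (concat (map (\<lambda>_. [H]) [0..<A]))"
    unfolding \<rho>(8)[symmetric]
  proof (rule runs_for)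
    fix i
    show "runs B m (writes [Var 5]) (\<rho>(1 := i)) 4 (\<rho>(1 := i)) [H]"
      by (rule runs_writesI) (use bd \<rho> in auto)
  qed (use bd \<rho> in auto)
  let ?c = "match_cost (gadget n U w)"
  let ?t = "time match_expr + 2"
  have row: "runs B m (for_loop 2 6 (writes [match_expr])) (\<rho>(1 := a)) (A * (?t + 7) + 4)
    (\<rho>(1 := a)) (concat (map (\<lambda>b. [?c a b]) [0..<A]))" if a: "a < A" for a
  proof -
    have "runs B m (for_loop 2 6 (writes [match_expr])) (\<rho>(1 := a))
      ((\<rho>(1 := a)) 6 * (?t + 7) + 4) (\<rho>(1 := a))
      (concat (map (\<lambda>b. [?c a b]) [0..<(\<rho>(1 := a)) 6]))"
    proof (rule runs_for)
      fix b assume "b < (\<rho>(1 := a)) 6"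
      then have b: "b < A"
        by (simp add: \<rho>)
      show "runs B m (writes [match_expr]) (\<rho>(1 := a, 2 := b)) ?t (\<rho>(1 := a, 2 := b)) [?c a b]"
        by (rule runs_writesI)
          (use match_expr[OF B m(2), of "\<rho>(1 := a, 2 := b)"] a b \<rho> vars_below_match_expr
            in \<open>auto simp: A_def\<close>)
    qed (use bd \<rho> in auto)
    then show ?thesis
      by (simp add: \<rho>)
  qed
  have table: "runs B m (for_loop 1 6 (for_loop 2 6 (writes [match_expr]))) \<rho>
    (A * (A * (?t + 7) + 4 + 7) + 4) \<rho>
    (concat (map (\<lambda>a. concat (map (\<lambda>b. [?c a b]) [0..<A])) [0..<A]))"
    unfolding \<rho>(8)[symmetric]
    by (rule runs_for) (use row bd \<rho> in auto)
  note run = runs_Seq[OF prefix(1) runs_Seq[OF prefix(2) runs_Seq[OF prefix(3) runs_Seq[OF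
    prefix(4) runs_Seq[OF prefix(5) runs_Seq[OF prefix(6) runs_Seq[OF alphabet runs_Seq[OF combs(1)
    runs_Seq[OF root runs_Seq[OF combs(2) runs_Seq[OF combs(3) runs_Seq[OF del table]]]]]]]]]]]]
  \<comment> \<open>The six empty lists are the outputs of the assignments. With them the right-hand
    side has the form that \<open>runs_Seq\<close> produces.\<close>
  have enc: "encode_instance (gadget n U w) = [] @ [] @ [] @ [] @ [] @ [] @ [A] @
    encode_tree (tree_F n) @ [6, 2] @ encode_tree (comb 0 n) @ encode_tree (comb 3 n) @
    concat (map (\<lambda>_. [H]) [0..<A]) @
    concat (map (\<lambda>a. concat (map (\<lambda>b. [?c a b]) [0..<A])) [0..<A])"
    by (simp add: encode_instance_def gadget_def A_def tree_G_def concat_map_singleton)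
  have "A * A \<le> length (encode_instance (gadget n U w))"
    by (simp add: enc length_concat comp_def sum_list_triv)
  have A: "A \<le> A * A" "1 \<le> A * A" "n \<le> A"
    by (simp_all add: A_def)
  let ?T = "4 + (time (pow_expr (Var 0) (K + 2)) + 2 + (7 + (18 + (6 +
      (8 + (4 + (2 * n * 48 + 18 + (5 + (n * 48 + 18 + (n * 48 + 18 + (A * (4 + 7) + 4 +
      (A * (A * (?t + 7) + 4 + 7) + 4))))))))))))"
  have runs: "runs B m (construct_gadget K) (\<lambda>_. 0) ?T \<rho> (encode_instance (gadget n U w))"
    unfolding construct_gadget_def enc by (rule run)
  \<comment> \<open>Naming the products makes the inequality linear. Every term is compared with
    \<open>A * A\<close>, and 1000 exceeds the sum of the numeric coefficients.\<close>
  have "?T \<le> time_factor K * (A * A)"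
  proof -
    define p where "p = time (pow_expr (Var 0) (K + 2))"
    define q where "q = A * (A * (?t + 7) + 4 + 7)"
    define x where "x = A * A"
    define y where "y = p * x"
    define z where "z = time match_expr * x"
    define u where "u = time_factor K * x"
    have "p * 1 \<le> y"
      unfolding y_def x_def using A by (intro mult_left_mono) auto
    moreover have "q = z + 9 * x + 11 * A"
      by (simp add: q_def z_def x_def algebra_simps)
    moreover have "u = y + z + 1000 * x"
      by (simp add: u_def time_factor_def p_def y_def z_def algebra_simps)
    moreover have "A \<le> x" "1 \<le> x"
      using A by (simp_all add: x_def)
    ultimately have "p + 192 * n + 11 * A + q + 116 \<le> u"
      using A(3) by linarith
    moreover have "4 + (p + 2 + (7 + (18 + (6 + (8 + (4 + (2 * n * 48 + 18 + (5 + (n * 48 + 18 +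
        (n * 48 + 18 + (A * (4 + 7) + 4 + (q + 4)))))))))))) = p + 192 * n + 11 * A + q + 116"
      by simp
    ultimately show ?thesis
      unfolding p_def[symmetric] q_def[symmetric] x_def[symmetric] u_def[symmetric]
      by (simp only:)
  qed
  also have "\<dots> \<le> time_factor K * length (encode_instance (gadget n U w))"
    using \<open>A * A \<le> _\<close> by (rule mult_left_mono) simp
  finally show ?thesis
    using runs by (intro exI[of _ ?T] exI[of _ \<rho>] conjI)
qed

end

theorem lemma2:
  fixes c :: real
  assumes "c > 0"
  shows "\<exists>(construct :: com) (extract :: com) (C :: nat) (k :: nat).
    \<forall>(n :: nat) (w :: nat \<Rightarrow> nat \<Rightarrow> nat). n \<ge> 3 \<longrightarrow> weighted_complete_graph c n w \<longrightarrow>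
      (\<exists>(I :: ted_instance) (t :: nat).
         wf_instance I \<and>
         computes (n ^ k) construct (encode_graph n w) t (encode_instance I) \<and>
         t \<le> C * length (encode_instance I) \<and>
         tree_size (tree1 I) \<le> C * n \<and>
         tree_size (tree2 I) \<le> C * n \<and>
         alphabet_size I \<le> C * n \<and>
         (\<exists>t'. computes (n ^ k) extract [n, ted I] t' [min_triangle_weight n w]))"
proof -
  \<comment> \<open>Rounding \<open>c\<close> up bounds the weights by the natural power
    \<open>n ^ K\<close>. The programs and constants depend on \<open>c\<close> only through
    \<open>K\<close>.\<close>
  define K where "K = nat \<lceil>c\<rceil>"
  show ?thesis
  proof (rule exI[of _ "construct_gadget K"], rule exI[of _ "extract_triangle K"],
      rule exI[of _ "time_factor K"], rule exI[of _ "K + 12"], intro allI impI)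
    fix n w assume n: "3 \<le> (n :: nat)" and G: "weighted_complete_graph c n w"
    \<comment> \<open>A power of \<open>n\<close> can be computed by both programs. The factor
      \<open>n ^ 2 \<ge> 9\<close> leaves room for the three edges of a triangle.\<close>
    define U where "U = n ^ (K + 2)"
    have n_pow: "3 ^ i \<le> n ^ i" for i
      using n by (rule power_mono) simp
    have w: "w i j \<le> n ^ K" if "i < n" "j < n" "i \<noteq> j" for i j
    proof -
      have "real (w i j) \<le> real n powr c"
        using G that by (auto simp: weighted_complete_graph_def)
      also have "\<dots> \<le> real n powr real K"
        using n by (intro powr_mono) (auto simp: K_def real_nat_ceiling_ge)
      also have "\<dots> = real (n ^ K)"
        using n by (simp add: powr_realpow)
      finally show ?thesis
        by simp
    qed
    interpret weights n U w
    proof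
      fix i j assume ij: "i < n" "j < n" "i \<noteq> j"
      have "3 * w i j \<le> 9 * n ^ K"
        using w[OF ij] by simp
      also have "\<dots> \<le> n ^ 2 * n ^ K"
        using n_pow[of 2] by (intro mult_right_mono) auto
      finally show "3 * w i j \<le> U"
        by (simp add: U_def power_add power2_eq_square mult_ac)
    qed (use n in \<open>auto simp: U_def\<close>)
    have H_eq: "H = n ^ (K + 6)"
    proof -
      have "4 + (K + 2) = K + 6"
        by simp
      then show ?thesis
        unfolding U_def power_add[symmetric] by (rule arg_cong)
    qed
    \<comment> \<open>The largest word is the edit distance, at most
      \<open>H * (12 * n + 2)\<close>. Six more factors \<open>n\<close> than in
      \<open>H = n ^ (K + 6)\<close> suffice, because \<open>n ^ 4 \<ge> 27 * n\<close> and
      \<open>n ^ 2 \<ge> 9\<close>.\<close>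
    define B where "B = n ^ (K + 12)"
    have HB: "H * (n ^ 4 * 9) \<le> B"
    proof -
      have "n ^ 4 * 9 \<le> n ^ 4 * n ^ 2"
        using n_pow[of 2] by (intro mult_left_mono) auto
      then have "n ^ (K + 6) * (n ^ 4 * 9) \<le> n ^ (K + 6) * (n ^ 4 * n ^ 2)"
        by (rule mult_left_mono) simp
      moreover have "n ^ (K + 6) * (n ^ 4 * n ^ 2) = B"
        unfolding B_def power_add[symmetric] by (rule arg_cong) simp
      ultimately show ?thesis
        unfolding H_eq by (rule ord_le_eq_trans)
    qed
    have n4: "27 * n \<le> n ^ 4"
    proof -
      have "3 ^ 3 * n \<le> n ^ 3 * n"
        using n_pow[of 3] by (rule mult_right_mono) simp
      then show ?thesis
        by (simp add: power_numeral_reduce)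
    qed
    have H_pos: "0 < H"
      using n by (simp add: U_def)
    have bounds: "8 * H \<le> B" "H * (12 * n + 2) < B" "n < B" "n ^ K < B" "0 < B" "12 * n + 1 < B" "1 < B"
      "12 < B" "12 * n < B"
    proof -
      have "1 * (n ^ 4 * 9) \<le> H * (n ^ 4 * 9)"
        using H_pos by (intro mult_right_mono) auto
      then have "n ^ 4 * 9 \<le> B"
        using HB by linarith
      then show "n < B" "0 < B" "12 * n + 1 < B" "1 < B" "12 < B" "12 * n < B"
        using n4 n by linarith+
      have "H * (12 * n + 2) < H * (n ^ 4 * 9)"
        using H_pos n4 n by (intro mult_strict_left_mono) linarith+
      then show "H * (12 * n + 2) < B"
        using HB by linarith
      have "H * 8 \<le> H * (n ^ 4 * 9)"
        using n4 n by (intro mult_left_mono) linarith+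
      then show "8 * H \<le> B"
        using HB by linarith
      show "n ^ K < B"
        unfolding B_def using n by (intro power_strict_increasing) auto
    qed
    let ?I = "gadget n U w"
    obtain T \<rho> where run: "runs B (mem (initial_state (encode_graph n w))) (construct_gadget K) (\<lambda>_. 0) T \<rho>
        (encode_instance ?I)" "T \<le> time_factor K * length (encode_instance ?I)"
      using runs_construct[OF U_def bounds(1) mem_encode_graph] by blast
    have "w i j < B" if "i < n" "j < n" "i \<noteq> j" for i j
      using w[OF that] bounds(4) by linarith
    then have "set (encode_graph n w) \<subseteq> {..<B}"
      using bounds(3,5) by (auto simp: encode_graph_def)
    from runs_computes[OF run(1) bounds(5) this] obtain t where
      t: "t \<le> T" "computes B (construct_gadget K) (encode_graph n w) t (encode_instance ?I)"
      by blast
    have ted: "ted ?I = H * (12 * n + 1) + min_triangle_weight n w" "ted ?I < B"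
    proof -
      show "ted ?I = H * (12 * n + 1) + min_triangle_weight n w"
        by (rule ted_gadget)
      moreover have "U \<le> H"
        using H_large by linarith
      moreover have "H * (12 * n + 2) = H * (12 * n + 1) + H"
        by (simp add: algebra_simps)
      ultimately have "ted ?I \<le> H * (12 * n + 2)"
        using min_triangle_le_U by linarith
      then show "ted ?I < B"
        using bounds(2) by linarith
    qed
    have "runs B (mem (initial_state [n, ted ?I])) (extract_triangle K) (\<lambda>_. 0)
      (Suc (\<Sum>e\<leftarrow>[Bin Minus (Mem (Cst 1)) (Bin Times (pow_expr (Mem (Cst 0)) (K + 6))
         (Bin Plus (Bin Times (Cst 12) (Mem (Cst 0))) (Cst 1)))]. Suc (time e))) (\<lambda>_. 0)
      [min_triangle_weight n w]"
      unfolding extract_triangle_def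
    proof (rule runs_writesI[OF _ order_refl])
      let ?m = "mem (initial_state [n, ted ?I])"
      have m: "?m 0 = n" "?m 1 = ted ?I"
        by (simp_all add: initial_state_def)
      have "safe B ?m (\<lambda>_. 0) (pow_expr (Mem (Cst 0)) (K + 6))"
        by (rule safe_pow_expr) (use m bounds n H_eq in auto)
      moreover have "n ^ (K + 6) * (12 * n + 1) < B"
        using ted unfolding H_eq by linarith
      moreover have "ted ?I - z < B" for z
        using ted(2) by linarith
      ultimately show "list_all (\<lambda>e. safe B ?m (\<lambda>_. 0) e \<and> vars_below nvars e)
        [Bin Minus (Mem (Cst 1)) (Bin Times (pow_expr (Mem (Cst 0)) (K + 6))
         (Bin Plus (Bin Times (Cst 12) (Mem (Cst 0))) (Cst 1)))]"
        using m ted(2) bounds by simp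
      show "map (val ?m (\<lambda>_. 0)) [Bin Minus (Mem (Cst 1)) (Bin Times (pow_expr (Mem (Cst 0)) (K + 6))
         (Bin Plus (Bin Times (Cst 12) (Mem (Cst 0))) (Cst 1)))] = [min_triangle_weight n w]"
        using m ted(1) unfolding H_eq by simp
    qed
    from runs_computes[OF this bounds(5)] obtain t' where
      t': "computes B (extract_triangle K) [n, ted ?I] t' [min_triangle_weight n w]"
      using bounds(3) ted(2) by auto
    have le: "1000 * n \<le> time_factor K * n"
      by (intro mult_right_mono) (auto simp: time_factor_def)
    have "tree_size (tree1 ?I) \<le> 1000 * n" "tree_size (tree2 ?I) \<le> 1000 * n"
      "alphabet_size ?I \<le> 1000 * n"
      using n by (simp_all add: gadget_def tree_size_F tree_size_G)
    note sizes = this[THEN order_trans, OF le]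
    have time: "t \<le> time_factor K * length (encode_instance ?I)"
      using t(1) run(2) by linarith
    show "\<exists>I t. wf_instance I \<and>
         computes (n ^ (K + 12)) (construct_gadget K) (encode_graph n w) t (encode_instance I) \<and>
         t \<le> time_factor K * length (encode_instance I) \<and>
         tree_size (tree1 I) \<le> time_factor K * n \<and>
         tree_size (tree2 I) \<le> time_factor K * n \<and>
         alphabet_size I \<le> time_factor K * n \<and>
         (\<exists>t'. computes (n ^ (K + 12)) (extract_triangle K) [n, ted I] t' [min_triangle_weight n w])"
    proof (rule exI[of _ ?I], rule exI[of _ t], intro conjI exI[of _ t'])
    qed (fact wf_gadget sizes time t(2)[unfolded B_def] t'[unfolded B_def])+
  qed
qed

end
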